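(* Let $d\ge1$, $s\in[1/2,1)$, $\lambda,\Lambda>0$ and $R_0>0$. There exists a constant $c>0$ depending only on $d,s,\lambda,\Lambda$ and $R_0$ such that the following holds. Let $\rho\ge0$, $a\ge0$, $R\in(\rho,R_0]$, and let $u\in L^\infty(\mathbb R^d\times I_R)$ satisfy $u\ge0$ in $\mathbb R^d\times\overline{I}_R$ and $$\partial_tu+\Lambda|\nabla u|-\mathcal M_\rho^-u\ge -R^{-2s}a\quad\text{in } Q_R$$ in the viscosity sense. Then $$\inf_{Q_{R/2}}u\ \ge\ c\int_{I_R\setminus I_{R/2}}\int_{\mathbb R^d}\frac{u(x,t)}{(R+|x|)^{d+2s}}\,dx\,dt-a .$$
   Context: Notation: $B_R(x)=\{y\in\mathbb R^d:|x-y|<R\}$, $B_R=B_R(0)$, $I_R=(-R^{2s},0]$, $\overline I_R=[-R^{2s},0]$, $Q_R=B_R\times I_R$. Kernels: with the convention that $\rho^{-d-2s}=\infty$ if $\rho=0$ (so $\min\{|y|^{-d-2s},\rho^{-d-2s}\}=|y|^{-d-2s}$), $\mathcal K_\rho$ is the set of all measurable $K:\mathbb R^d\to[0,\infty)$ such that (1) $K(y)\ge\lambda\min\{|y|^{-d-2s},\rho^{-d-2s}\}$ for all $y\ne0$; (2) $\int_{B_{2r}\setminus B_r}K(y)\,dy\le\Lambda r^{-2s}$ for all $r>0$; (3) if $s=1/2$, additionally $\int_{B_{2r}\setminus B_r}yK(y)\,dy=0$ for all $r>0$. Operators (acting in space): $\delta_yu(x)=u(x+y)-u(x)$ if $s<1/2$;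 $\delta_yu(x)=u(x+y)-u(x)-y\cdot\nabla u(x)\mathbf 1_{B_1}(y)$ if $s=1/2$; $\delta_yu(x)=u(x+y)-u(x)-y\cdot\nabla u(x)$ if $s>1/2$. $L_Ku(x)=\int_{\mathbb R^d}\delta_yu(x)K(y)\,dy$, $\mathcal M_\rho^-u(x)=\inf_{K\in\mathcal K_\rho}L_Ku(x)$. It is tacitly assumed that $\mathcal K_\rho\neq\emptyset$. Since functions are evaluated pointwise, $L^\infty(\mathbb R^d\times I)$ means bounded Borel measurable functions defined everywhere. Viscosity sense: let $\Omega\subseteq\mathbb R^d$ be a domain, $I\subseteq(-\infty,0]$ a left-open interval and $f:\Omega\times I\to\mathbb R$; $\partial_t$ is the left derivative in time. A function $u\in L^\infty(\mathbb R^d\times I)$ that is lower semicontinuous in $\Omega\times I$ satisfies $\partial_tu+\Lambda|\nabla u|-\mathcal M_\rho^-u\ge f$ in $\Omega\times I$ in the viscosity sense if for every $(x_0,t_0)\in\Omega\times I$, every $\varepsilon>0$ with $B_\varepsilon(x_0)\times(t_0-\varepsilon,t_0]\subseteq\Omega\times I$ and every $\varphi:B_\varepsilon(x_0)\times(t_0-\varepsilon,t_0]\to\mathbb R$ that is left-differentiable in time and $C^{1,1}$ in space with $u(x_0,t_0)=\varphi(x_0,t_0)$ and $u\ge\varphi$ in $B_\varepsilon(x_0)\times(t_0-\varepsilon,t_0]$, the function $v$ equal to $\varphi$ in $B_\varepsilon(x_0)\times(t_0-\varepsilon,t_0]$ and to $u$ elsewhere in $\mathbb R^d\times I$ satisfies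 $\partial_tv(x_0,t_0)+\Lambda|\nabla v(x_0,t_0)|-\mathcal M_\rho^-v(x_0,t_0)\ge f(x_0,t_0)$. *)

theory Defs
  imports "HOL-Analysis.Analysis"
begin

text \<open>
  The space \<open>\<real>\<^sup>d\<close> is a type \<open>'a :: euclidean_space\<close> with \<open>DIM('a) = d\<close>; functions of space and
  time are functions on \<open>'a \<times> real\<close>, of which only the values on the relevant set matter.
\<close>

definition time_int :: "real \<Rightarrow> real \<Rightarrow> real set" where
  "time_int s R = {- (R powr (2 * s))<..0}"

definition cyl :: "real \<Rightarrow> real \<Rightarrow> ('a::euclidean_space \<times> real) set" where
  "cyl s R = ball 0 R \<times> time_int s R"

text \<open>
  The kernel class. The case distinction implements the convention \<open>\<rho>\<^bsup>-d-2s\<^esup> = \<infinity>\<close> for \<open>\<rho> = 0\<close>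
  (in HOL, \<open>0 powr a = 0\<close>). The annulus bound uses the Lebesgue integral with values in
  \<open>[0, \<infinity>]\<close>, so it includes integrability of the kernel on annuli.
\<close>

definition kernels :: "real \<Rightarrow> real \<Rightarrow> real \<Rightarrow> real \<Rightarrow> ('a::euclidean_space \<Rightarrow> real) set" where
  "kernels s lam Lam \<rho> = {K. K \<in> borel_measurable borel \<and> (\<forall>y. 0 \<le> K y) \<and>
     (\<forall>y. y \<noteq> 0 \<longrightarrow>
        K y \<ge> lam * (if \<rho> = 0 then norm y powr (- real DIM('a) - 2 * s)
                     else min (norm y powr (- real DIM('a) - 2 * s))
                              (\<rho> powr (- real DIM('a) - 2 * s)))) \<and>
     (\<forall>r>0. (\<integral>\<^sup>+ y\<in>ball 0 (2 * r) - ball 0 r. ennreal (K y) \<partial>lborel)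
              \<le> ennreal (Lam * r powr (- 2 * s))) \<and>
     (s = 1/2 \<longrightarrow>
        (\<forall>r>0. (LINT y:(ball 0 (2 * r) - ball 0 r)|lborel. K y *\<^sub>R y) = 0))}"

definition gradient :: "('a::euclidean_space \<Rightarrow> real) \<Rightarrow> 'a \<Rightarrow> 'a" where
  "gradient w x = (THE D. GDERIV w x :> D)"

definition delta :: "real \<Rightarrow> 'a::euclidean_space \<Rightarrow> ('a \<Rightarrow> real) \<Rightarrow> 'a \<Rightarrow> real" where
  "delta s y w x =
     (if s < 1/2 then w (x + y) - w x
      else if s = 1/2 then w (x + y) - w x - (y \<bullet> gradient w x) * indicator (ball 0 1) y
      else w (x + y) - w x - y \<bullet> gradient w x)"

definition L_op :: "real \<Rightarrow> ('a::euclidean_space \<Rightarrow> real) \<Rightarrow> ('a \<Rightarrow> real) \<Rightarrow> 'a \<Rightarrow> real" where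
  "L_op s K w x = (LINT y|lborel. delta s y w x * K y)"

text \<open>
  The infimum is taken in \<open>\<real>\<close>. In the definition of viscosity supersolutions below the operator
  acts on bounded Borel functions that are \<open>C\<^bsup>1,1\<^esup>\<close> near the point \<open>x\<close>; for these the integrals
  \<open>L_op\<close> converge absolutely and are bounded uniformly in the kernel, by the annulus bound.
\<close>

definition M_minus ::
  "real \<Rightarrow> real \<Rightarrow> real \<Rightarrow> real \<Rightarrow> ('a::euclidean_space \<Rightarrow> real) \<Rightarrow> 'a \<Rightarrow> real" where
  "M_minus s lam Lam \<rho> w x = (INF K\<in>kernels s lam Lam \<rho>. L_op s K w x)"

definition Linfty :: "'b::topological_space set \<Rightarrow> ('b \<Rightarrow> real) set" where
  "Linfty S = {u. u \<in> borel_measurable (restrict_space borel S) \<and> bounded (u ` S)}"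

definition lsc_on :: "'b::topological_space set \<Rightarrow> ('b \<Rightarrow> real) \<Rightarrow> bool" where
  "lsc_on S u \<longleftrightarrow> (\<forall>z\<in>S. \<forall>a<u z. \<forall>\<^sub>F w in at z within S. a < u w)"

definition C11_on :: "'a::euclidean_space set \<Rightarrow> ('a \<Rightarrow> real) \<Rightarrow> bool" where
  "C11_on S w \<longleftrightarrow>
     (\<exists>G C. (\<forall>x\<in>S. GDERIV w x :> G x) \<and> C-lipschitz_on S G)"

definition left_deriv :: "(real \<Rightarrow> real) \<Rightarrow> real \<Rightarrow> real" where
  "left_deriv g t = vector_derivative g (at_left t)"

definition visc_super ::
  "real \<Rightarrow> real \<Rightarrow> real \<Rightarrow> real \<Rightarrow> 'a::euclidean_space set \<Rightarrow> real set
     \<Rightarrow> ('a \<times> real \<Rightarrow> real) \<Rightarrow> ('a \<times> real \<Rightarrow> real) \<Rightarrow> bool" where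
  "visc_super s lam Lam \<rho> \<Omega> I f u \<longleftrightarrow>
     u \<in> Linfty (UNIV \<times> I) \<and> lsc_on (\<Omega> \<times> I) u \<and>
     (\<forall>x0\<in>\<Omega>. \<forall>t0\<in>I. \<forall>\<epsilon>>0. \<forall>\<phi>.
        let N = ball x0 \<epsilon> \<times> {t0 - \<epsilon><..t0};
            v = (\<lambda>z. if z \<in> N then \<phi> z else u z)
        in N \<subseteq> \<Omega> \<times> I \<longrightarrow>
           (\<forall>(x, t)\<in>N. (\<lambda>\<tau>. \<phi> (x, \<tau>)) differentiable (at_left t)) \<longrightarrow>
           (\<forall>t\<in>{t0 - \<epsilon><..t0}. C11_on (ball x0 \<epsilon>) (\<lambda>x. \<phi> (x, t))) \<longrightarrow>
           u (x0, t0) = \<phi> (x0, t0) \<longrightarrow>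
           (\<forall>z\<in>N. u z \<ge> \<phi> z) \<longrightarrow>
           left_deriv (\<lambda>\<tau>. v (x0, \<tau>)) t0
             + Lam * norm (gradient (\<lambda>x. v (x, t0)) x0)
             - M_minus s lam Lam \<rho> (\<lambda>x. v (x, t0)) x0 \<ge> f (x0, t0))"

end

theory Submission
  imports Defs
begin

text \<open>
  The proof compares \<open>u\<close> with an explicit barrier. Put \<open>T = R\<^bsup>2s\<^esup>\<close>, \<open>\<eta>(x) = (max 0 (1 - |x|\<^sup>2/R\<^sup>2))\<^sup>2\<close> and
  \<open>G(t) = \<integral> u(x,t) (R + |x|)\<^bsup>-d-2s\<^esup> dx\<close>. The barrier is
  \<open>\<psi>(x,t) = c e\<^bsup>-C(t+T)/T\<^esup> m(t) \<eta>(x) - a (t + T)/T\<close>, where \<open>m\<close> starts from \<open>0\<close> at time \<open>-T\<close> and grows at rate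
  \<open>G\<close> during \<open>I\<^sub>R - I\<^bsub>R/2\<^esub>\<close>. Since \<open>\<eta> \<ge> 9/16\<close> on \<open>B\<^bsub>R/2\<^esub>\<close> and \<open>m\<close> has collected the integral of \<open>G\<close> from then on, the
  inequality \<open>u \<ge> \<psi>\<close> implies the claim.

  It holds because of nonlocality. Suppose that \<open>\<psi>\<close>, lowered by a constant, touches \<open>u\<close> from below at
  \<open>(x\<^sub>0,t\<^sub>0)\<close>. The operator at \<open>x\<^sub>0\<close> sees the excess of \<open>u\<close> over the barrier everywhere in space, through the lower
  bound \<open>K(y) \<ge> \<lambda> (R + |y|)\<^bsup>-d-2s\<^esup>\<close>, which holds since \<open>\<rho> < R\<close>. This contributes \<open>c G(t\<^sub>0)\<close> and pays for the
  growth of \<open>m\<close>. The bump, its gradient and the part of the barrier inside the excess cost at most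
  \<open>C M \<eta>(x\<^sub>0)/T\<close> with \<open>M = c e\<^bsup>-C(t\<^sub>0+T)/T\<^esup> m(t\<^sub>0)\<close>, which the decay of the exponential pays for
  (\<open>M_minus_touching_lower_bound\<close>).

  Three points need care. First, near the boundary of the ball the gradient and the second differences of
  \<open>\<eta>\<close> are of the order \<open>\<surd>\<eta>\<close>, much larger than \<open>\<eta>\<close> itself; there the mass of \<open>\<eta>\<close> in the half ball, seen
  from \<open>x\<^sub>0\<close>, gives a positive contribution of fixed size that dominates them (\<open>L_op_touching_lower_bound\<close>,
  \<open>quadratic_absorption\<close>). Second, \<open>G\<close> is only measurable in time, whereas test functions are left
  differentiable everywhere. So \<open>m\<close> is taken to be a continuous function that loses an arbitrarily small
  part of the integral of \<open>G\<close> and whose upper left Dini derivative is at most \<open>G\<close> at every time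
  (\<open>dini_minorant_exists\<close>); at the time of contact a line below \<open>m\<close> takes its place
  (\<open>barrier_below_supersolution\<close>). Third, for \<open>s = 1/2\<close> the gradient is cut off at radius \<open>1\<close> and not at the
  radius \<open>R\<close> to which the estimate has to scale; the cancellation condition bounds the difference
  (\<open>kernel_change_cutoff\<close>).
\<close>

section \<open>Continuous minorants of an integral with a pointwise Dini bound\<close>

text \<open>
  The growth rate available to the barrier at time \<open>t\<close> is a tail integral of the supersolution, which
  is merely measurable in \<open>t\<close>; its primitive need not be left differentiable, and at exceptional times
  it may grow faster than the rate. A function with this property grows by almost the whole integral of
  \<open>f\<close> and yet never faster than \<open>f t\<close> to the left of \<open>t\<close>, for every single \<open>t\<close>.
\<close>

definition dini_minorant :: "(real \<Rightarrow> real) \<Rightarrow> real \<Rightarrow> (real \<Rightarrow> real) \<Rightarrow> bool" where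
  "dini_minorant f e m \<longleftrightarrow> continuous_on UNIV m
     \<and> (\<forall>t. 0 \<le> m t \<and> m t \<le> (LINT x:{..t}|lborel. f x) \<and> (LINT x:{..t}|lborel. f x) \<le> m t + e)
     \<and> (\<forall>t d. 0 < d \<longrightarrow> (\<forall>\<^sub>F \<tau> in at_left t. m t - m \<tau> \<le> (f t + d) * (t - \<tau>)))"

lemma set_integrable_atMost:
  fixes f :: "real \<Rightarrow> real"
  assumes "integrable lborel f"
  shows "set_integrable lborel {..t} f"
  using assms unfolding set_integrable_def by (intro integrable_mult_indicator) auto

text \<open>
  For \<open>f = 1\<^sub>A\<close> the minorant is \<open>t \<mapsto> |K \<inter> (-\<infinity>, t]|\<close> with \<open>K \<subseteq> A\<close> closed and \<open>|A - K| \<le> e\<close>. It is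
  1-Lipschitz, and it is locally constant off \<open>K\<close>, hence in particular off \<open>A\<close>.
\<close>

lemma dini_minorant_indicator:
  fixes A :: "real set"
  assumes A: "A \<in> sets borel" and int: "integrable lborel (indicator A :: real \<Rightarrow> real)" and "0 < e"
  shows "\<exists>m. dini_minorant (indicator A) e m"
proof -
  have finA: "emeasure lborel A < \<infinity>"
    using int A by (simp add: integrable_indicator_iff)
  obtain K where K: "closed K" "K \<subseteq> A" "A - K \<in> lmeasurable" "emeasure lebesgue (A - K) < ennreal e"
    using sets_lebesgue_inner_closed[of A e] A \<open>0 < e\<close> by auto
  have Kb [measurable]: "K \<in> sets borel" using K by auto
  note A [measurable]
  have fin: "emeasure lborel (A \<inter> B) < \<infinity>" "emeasure lborel (K \<inter> B) < \<infinity>" if "B \<in> sets borel" for B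
  proof -
    have "emeasure lborel (A \<inter> B) \<le> emeasure lborel A" "emeasure lborel (K \<inter> B) \<le> emeasure lborel A"
      using K(2) A by (auto intro!: emeasure_mono)
    then show "emeasure lborel (A \<inter> B) < \<infinity>" "emeasure lborel (K \<inter> B) < \<infinity>"
      using finA by (blast intro: le_less_trans)+
  qed
  define m where "m t = measure lborel (K \<inter> {..t})" for t
  have diff: "m t - m \<tau> = measure lborel (K \<inter> {\<tau><..t})" if "\<tau> \<le> t" for t \<tau>
  proof -
    have "K \<inter> {..t} = K \<inter> {..\<tau>} \<union> K \<inter> {\<tau><..t}" using that by auto
    then have "m t = measure lborel (K \<inter> {..\<tau>} \<union> K \<inter> {\<tau><..t})" by (simp add: m_def)
    also have "\<dots> = m \<tau> + measure lborel (K \<inter> {\<tau><..t})"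
      unfolding m_def using fin by (intro measure_Union) (auto simp: less_top)
    finally show ?thesis by simp
  qed
  have diff_le: "m t - m \<tau> \<le> t - \<tau>" if "\<tau> \<le> t" for t \<tau>
  proof -
    have "measure lborel (K \<inter> {\<tau><..t}) \<le> measure lborel {\<tau><..t}"
      using that by (intro measure_mono_fmeasurable) (auto simp: fmeasurable_def)
    then show ?thesis using diff[OF that] that by simp
  qed
  have diff_ge: "0 \<le> m t - m \<tau>" if "\<tau> \<le> t" for t \<tau>
    using diff[OF that] by simp
  have "1-lipschitz_on UNIV m"
  proof (rule lipschitz_onI)
    show "dist (m x) (m y) \<le> 1 * dist x y" for x y
      using diff_le[of x y] diff_ge[of x y] diff_le[of y x] diff_ge[of y x]
      by (auto simp: dist_real_def abs_if)
  qed auto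
  then have cont: "continuous_on UNIV m" by (rule lipschitz_on_continuous_on)
  have intA: "(LINT x:{..t}|lborel. indicator A x) = measure lborel (A \<inter> {..t})" for t :: real
    by (simp add: set_lebesgue_integral_def indicator_inter_arith[symmetric] Int_commute mult.commute)
  have up: "m t \<le> measure lborel (A \<inter> {..t})" for t
    unfolding m_def using K(2) fin(1)[of "{..t}"]
    by (intro measure_mono_fmeasurable) (auto simp: fmeasurable_def)
  have lo: "measure lborel (A \<inter> {..t}) \<le> m t + e" for t
  proof -
    have "measure lborel (A - K) \<le> e"
    proof -
      have "emeasure lborel (A - K) \<le> ennreal e"
        using K(4) A by simp
      then show ?thesis using \<open>0 < e\<close> by (simp add: measure_def enn2real_leI)
    qed
    moreover have "measure lborel (A \<inter> {..t}) \<le> measure lborel ((K \<inter> {..t}) \<union> (A - K))"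
      using fin[of "{..t}"] fin(1)[of "-K"]
      by (intro measure_mono_fmeasurable fmeasurable.Un) (auto simp: fmeasurable_def Diff_eq)
    moreover have "measure lborel ((K \<inter> {..t}) \<union> (A - K)) \<le> m t + measure lborel (A - K)"
      unfolding m_def by (intro measure_Un_le) auto
    ultimately show ?thesis by linarith
  qed
  have dini: "\<forall>\<^sub>F \<tau> in at_left t. m t - m \<tau> \<le> (indicator A t + d) * (t - \<tau>)" if "0 < d" for t d
  proof (cases "t \<in> K")
    case True
    then have "indicator A t = (1::real)" using K(2) by auto
    moreover have "\<forall>\<^sub>F \<tau> in at_left t. \<tau> < t" by (simp add: eventually_at_filter)
    then have "\<forall>\<^sub>F \<tau> in at_left t. m t - m \<tau> \<le> (1 + d) * (t - \<tau>)"
    proof eventually_elim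
      case (elim \<tau>)
      have "m t - m \<tau> \<le> t - \<tau>" using diff_le elim by simp
      also have "\<dots> \<le> (1 + d) * (t - \<tau>)" using that elim by (simp add: algebra_simps)
      finally show ?case .
    qed
    ultimately show ?thesis by simp
  next
    case False
    then obtain r where r: "r > 0" "ball t r \<inter> K = {}"
      using K(1) by (metis ComplI Int_commute disjoint_eq_subset_Compl open_Compl openE)
    have "\<forall>\<^sub>F \<tau> in at_left t. \<tau> \<in> {t - r<..<t}"
      using r(1) by (intro eventually_at_leftI[of "t - r"]) auto
    then show ?thesis
    proof eventually_elim
      case (elim \<tau>)
      have "K \<inter> {\<tau><..t} = {}" using r(2) elim by (force simp: dist_real_def)
      then have "m t - m \<tau> = 0" using diff[of \<tau> t] elim by simp
      then show ?case using that elim by (simp add: indicator_def)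
    qed
  qed
  have "dini_minorant (indicator A) e m"
    unfolding dini_minorant_def intA using cont up lo dini by (auto simp: m_def)
  then show ?thesis by blast
qed

lemma dini_minorant_mult:
  assumes "dini_minorant f e m" "0 < c"
  shows "dini_minorant (\<lambda>t. c * f t) (c * e) (\<lambda>t. c * m t)"
proof -
  have "\<forall>\<^sub>F \<tau> in at_left t. c * m t - c * m \<tau> \<le> (c * f t + d) * (t - \<tau>)" if "0 < d" for t d
  proof -
    have "\<forall>\<^sub>F \<tau> in at_left t. m t - m \<tau> \<le> (f t + d / c) * (t - \<tau>)"
      using assms that by (simp add: dini_minorant_def)
    then show ?thesis
    proof eventually_elim
      case (elim \<tau>)
      have "c * (m t - m \<tau>) \<le> c * ((f t + d / c) * (t - \<tau>))"
        using elim \<open>0 < c\<close> by (intro mult_left_mono) auto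
      also have "\<dots> = (c * f t + d) * (t - \<tau>)"
        using \<open>0 < c\<close> by (simp add: field_simps)
      finally show ?case by (simp add: right_diff_distrib)
    qed
  qed
  moreover have "(LINT x:{..t}|lborel. c * f x) = c * (LINT x:{..t}|lborel. f x)" for t
    by simp
  moreover have "continuous_on UNIV (\<lambda>t. c * m t)"
    using assms by (auto simp: dini_minorant_def intro: continuous_intros)
  ultimately show ?thesis
    using assms unfolding dini_minorant_def
    by (auto simp flip: distrib_left)
qed

lemma dini_minorant_add:
  assumes "dini_minorant f e m" "dini_minorant g e' n" "integrable lborel f" "integrable lborel g"
  shows "dini_minorant (\<lambda>t. f t + g t) (e + e') (\<lambda>t. m t + n t)"
proof -
  have "\<forall>\<^sub>F \<tau> in at_left t. m t + n t - (m \<tau> + n \<tau>) \<le> (f t + g t + d) * (t - \<tau>)" if "0 < d" for t d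
  proof -
    have "\<forall>\<^sub>F \<tau> in at_left t. m t - m \<tau> \<le> (f t + d/2) * (t - \<tau>)"
      "\<forall>\<^sub>F \<tau> in at_left t. n t - n \<tau> \<le> (g t + d/2) * (t - \<tau>)"
      using assms that half_gt_zero[OF that] unfolding dini_minorant_def by blast+
    then show ?thesis
    proof eventually_elim
      case (elim \<tau>)
      have "f t + g t + d = (f t + d/2) + (g t + d/2)" by linarith
      then have "(f t + g t + d) * (t - \<tau>) = (f t + d/2) * (t - \<tau>) + (g t + d/2) * (t - \<tau>)"
        by (simp only: distrib_right)
      then show ?case using elim by linarith
    qed
  qed
  moreover have "(LINT x:{..t}|lborel. f x + g x) = (LINT x:{..t}|lborel. f x) + (LINT x:{..t}|lborel. g x)" for t
    using assms by (intro set_integral_add set_integrable_atMost)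
  moreover have "continuous_on UNIV (\<lambda>t. m t + n t)"
    using assms by (auto simp: dini_minorant_def intro: continuous_intros)
  ultimately have *: "continuous_on UNIV (\<lambda>t. m t + n t)"
    "\<And>t. (LINT x:{..t}|lborel. f x + g x) = (LINT x:{..t}|lborel. f x) + (LINT x:{..t}|lborel. g x)"
    "\<And>t d. 0 < d \<Longrightarrow> \<forall>\<^sub>F \<tau> in at_left t. m t + n t - (m \<tau> + n \<tau>) \<le> (f t + g t + d) * (t - \<tau>)"
    by blast+
  show ?thesis
  proof -
    have "0 \<le> m t + n t \<and> m t + n t \<le> (LINT x:{..t}|lborel. f x) + (LINT x:{..t}|lborel. g x)
        \<and> (LINT x:{..t}|lborel. f x) + (LINT x:{..t}|lborel. g x) \<le> m t + n t + (e + e')" for t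
    proof -
      have "0 \<le> m t" "m t \<le> (LINT x:{..t}|lborel. f x)" "(LINT x:{..t}|lborel. f x) \<le> m t + e"
        "0 \<le> n t" "n t \<le> (LINT x:{..t}|lborel. g x)" "(LINT x:{..t}|lborel. g x) \<le> n t + e'"
        using assms(1,2) by (simp_all add: dini_minorant_def)
      then show ?thesis by linarith
    qed
    with * show ?thesis by (simp add: dini_minorant_def)
  qed
qed

text \<open>
  The general case follows from indicators by the induction along simple functions. In the limit step a
  single approximant \<open>U i \<le> f\<close> with nearly the same total integral serves, since a Dini bound by \<open>U i\<close>
  is a Dini bound by \<open>f\<close>.
\<close>

lemma dini_minorant_exists:
  assumes "f \<in> borel_measurable lborel" "\<And>t. 0 \<le> f t" "integrable lborel f" "0 < e"
  shows "\<exists>m. dini_minorant f e m"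
  using assms
proof (induction arbitrary: e rule: borel_measurable_induct_real)
  case (set A)
  then show ?case by (intro dini_minorant_indicator) auto
next
  case (mult f c)
  show ?case
  proof (cases "c = 0")
    case True
    have "dini_minorant (\<lambda>t. 0) e (\<lambda>t. 0)"
      using mult.prems
      by (auto simp: dini_minorant_def set_lebesgue_integral_def eventually_at_filter)
    then show ?thesis using True by auto
  next
    case False
    then have "c > 0" using mult by simp
    then have "integrable lborel f" using mult.prems(1) by simp
    then obtain m where "dini_minorant f (e / c) m"
      using mult.IH[of "e / c"] mult.prems \<open>c > 0\<close> by auto
    from dini_minorant_mult[OF this \<open>c > 0\<close>] show ?thesis
      using False by auto
  qed
next
  case (add f g)
  have "integrable lborel f" "integrable lborel g"
    using add by (auto intro!: Bochner_Integration.integrable_bound[OF add.prems(1)])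
  moreover from this obtain m n where "dini_minorant f (e / 2) m" "dini_minorant g (e / 2) n"
    using add.IH[of "e / 2"] \<open>0 < e\<close> by auto
  ultimately have "dini_minorant (\<lambda>t. g t + f t) (e / 2 + e / 2) (\<lambda>t. n t + m t)"
    by (intro dini_minorant_add) auto
  then show ?case by auto
next
  case (seq U)
  have le: "U i x \<le> f x" for i x
    using seq.hyps(3,4) by (intro incseq_le) (auto simp: incseq_def le_fun_def)
  have intU: "integrable lborel (U i)" for i
    using seq.hyps(1,2) le
    by (intro Bochner_Integration.integrable_bound[OF seq.prems(1)]) (auto intro!: AE_I2 order_trans[OF le abs_ge_self])
  have "(\<lambda>i. LINT x|lborel. U i x) \<longlonglongrightarrow> (LINT x|lborel. f x)"
    using seq le by (intro integral_dominated_convergence[where w=f]) auto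
  then have "\<forall>\<^sub>F i in sequentially. (LINT x|lborel. f x) - e / 2 < (LINT x|lborel. U i x)"
    using \<open>0 < e\<close> by (intro order_tendstoD(1)) auto
  then obtain i where i: "(LINT x|lborel. f x) - e / 2 < (LINT x|lborel. U i x)"
    by (auto simp: eventually_sequentially)
  obtain m where m: "dini_minorant (U i) (e / 2) m"
    using seq.IH[of i "e / 2"] intU \<open>0 < e\<close> by auto
  have le1: "(LINT x:{..t}|lborel. U i x) \<le> (LINT x:{..t}|lborel. f x)" for t
    using intU seq.prems le by (intro set_integral_mono set_integrable_atMost) auto
  have le2: "(LINT x:{..t}|lborel. f x) \<le> (LINT x:{..t}|lborel. U i x) + e / 2" for t
  proof -
    have "(LINT x:{..t}|lborel. f x) - (LINT x:{..t}|lborel. U i x) = (LINT x:{..t}|lborel. f x - U i x)"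
      using intU seq.prems by (intro set_integral_diff(2)[symmetric] set_integrable_atMost)
    also have "\<dots> \<le> (LINT x|lborel. f x - U i x)"
      unfolding set_lebesgue_integral_def using intU seq.prems le
      by (intro integral_mono integrable_mult_indicator Bochner_Integration.integrable_diff)
         (auto simp: indicator_def)
    also have "\<dots> \<le> e / 2" using intU seq.prems i by simp
    finally show ?thesis by simp
  qed
  have "dini_minorant f e m"
    unfolding dini_minorant_def
  proof (intro conjI allI impI)
    show "continuous_on UNIV m" using m by (simp add: dini_minorant_def)
    fix t
    show "0 \<le> m t" using m by (simp add: dini_minorant_def)
    show "m t \<le> (LINT x:{..t}|lborel. f x)"
      using m le1[of t] unfolding dini_minorant_def by (meson order_trans)
    have "(LINT x:{..t}|lborel. U i x) \<le> m t + e / 2"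
      using m unfolding dini_minorant_def by blast
    then show "(LINT x:{..t}|lborel. f x) \<le> m t + e"
      using le2[of t] by linarith
    fix d :: real assume "0 < d"
    then have "\<forall>\<^sub>F \<tau> in at_left t. m t - m \<tau> \<le> (U i t + d) * (t - \<tau>)"
      using m by (simp add: dini_minorant_def)
    moreover have "\<forall>\<^sub>F \<tau> in at_left t. \<tau> < t" by (simp add: eventually_at_filter)
    ultimately show "\<forall>\<^sub>F \<tau> in at_left t. m t - m \<tau> \<le> (f t + d) * (t - \<tau>)"
    proof eventually_elim
      case (elim \<tau>)
      have "(U i t + d) * (t - \<tau>) \<le> (f t + d) * (t - \<tau>)"
        using le elim by (intro mult_right_mono) auto
      then show ?case using elim by linarith
    qed
  qed
  then show ?case by blast
qed

section \<open>Lower semicontinuous functions\<close>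

lemma lsc_on_attains_min:
  fixes g :: "'b::topological_space \<Rightarrow> real"
  assumes "compact S" "S \<noteq> {}" "lsc_on S g"
  obtains z where "z \<in> S" "\<And>w. w \<in> S \<Longrightarrow> g z \<le> g w"
proof (rule ccontr)
  assume not_thesis: "\<not> thesis"
  note min = that
  have no_min: "\<exists>w\<in>S. g w < g z" if z: "z \<in> S" for z
  proof (rule ccontr)
    assume "\<not> ?thesis"
    then have "\<And>w. w \<in> S \<Longrightarrow> g z \<le> g w" by (auto simp: not_less)
    then have "thesis" by (rule min[OF z])
    with not_thesis show False ..
  qed
  have nb: "\<exists>V. open V \<and> z \<in> V \<and> (\<forall>w\<in>V \<inter> S. g y < g w)" if "z \<in> S" "g y < g z" for z y
  proof -
    have "\<forall>\<^sub>F w in at z within S. g y < g w" using assms(3) that by (simp add: lsc_on_def)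
    then have "\<exists>V. open V \<and> z \<in> V \<and> (\<forall>w\<in>V. w \<noteq> z \<longrightarrow> w \<in> S \<longrightarrow> g y < g w)"
      by (simp only: eventually_at_topological)
    then obtain V where V: "open V" "z \<in> V" "\<And>w. w \<in> V \<Longrightarrow> w \<noteq> z \<Longrightarrow> w \<in> S \<Longrightarrow> g y < g w"
      by auto
    have "g y < g w" if "w \<in> V \<inter> S" for w
      using V(3)[of w] that \<open>g y < g z\<close> by (cases "w = z") auto
    with V(1,2) show ?thesis by auto
  qed
  define \<C> where "\<C> = {V. open V \<and> (\<exists>y\<in>S. \<forall>w\<in>V \<inter> S. g y < g w)}"
  have cover: "S \<subseteq> \<Union>\<C>"
  proof
    fix z assume z: "z \<in> S"
    obtain y where y: "y \<in> S" "g y < g z" using no_min[OF z] by blast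
    obtain V where "open V" "z \<in> V" "\<forall>w\<in>V \<inter> S. g y < g w" using nb[OF z y(2)] by blast
    then show "z \<in> \<Union>\<C>" using y(1) by (auto simp: \<C>_def)
  qed
  obtain D where D: "D \<subseteq> \<C>" "finite D" "S \<subseteq> \<Union>D"
    by (rule compactE[OF assms(1) cover]) (auto simp: \<C>_def)
  have ex: "\<forall>V\<in>D. \<exists>y. y \<in> S \<and> (\<forall>w\<in>V \<inter> S. g y < g w)" using D(1) by (auto simp: \<C>_def)
  from bchoice[OF ex] obtain y where "\<forall>V\<in>D. y V \<in> S \<and> (\<forall>w\<in>V \<inter> S. g (y V) < g w)" ..
  then have y: "\<And>V. V \<in> D \<Longrightarrow> y V \<in> S \<and> (\<forall>w\<in>V \<inter> S. g (y V) < g w)" by simp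
  have "D \<noteq> {}" using D(3) assms(2) by auto
  \<comment> \<open>The comparison point with the least value is itself covered, which is absurd.\<close>
  define m where "m = Min ((\<lambda>V. g (y V)) ` D)"
  have "m \<in> (\<lambda>V. g (y V)) ` D" unfolding m_def using D(2) \<open>D \<noteq> {}\<close> by (intro Min_in) auto
  then obtain V where V: "V \<in> D" "m = g (y V)" by blast
  then obtain W where W: "W \<in> D" "y V \<in> W" using y D(3) by blast
  have "g (y W) < m" using y[OF W(1)] y[OF V(1)] W(2) V(2) by blast
  moreover have "m \<le> g (y W)" unfolding m_def using D(2) W(1) by (intro Min_le) auto
  ultimately show False by simp
qed

lemma lsc_on_diff_continuous:
  fixes u \<psi> :: "'b::topological_space \<Rightarrow> real"
  assumes "lsc_on S u" "continuous_on S \<psi>"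
  shows "lsc_on S (\<lambda>z. u z - \<psi> z)"
  unfolding lsc_on_def
proof (intro ballI allI impI)
  fix z a assume z: "z \<in> S" and a: "a < u z - \<psi> z"
  define d where "d = (u z - \<psi> z - a) / 2"
  have d: "0 < d" using a by (simp add: d_def)
  have "\<forall>\<^sub>F w in at z within S. u z - d < u w"
    using assms(1) z d by (simp add: lsc_on_def)
  moreover have "\<forall>\<^sub>F w in at z within S. \<psi> w < \<psi> z + d"
    using assms(2) z d unfolding continuous_on_def by (intro order_tendstoD) auto
  ultimately show "\<forall>\<^sub>F w in at z within S. a < u w - \<psi> w"
    by eventually_elim (simp add: d_def field_simps)
qed

lemma lsc_on_subset: "lsc_on S u \<Longrightarrow> S' \<subseteq> S \<Longrightarrow> lsc_on S' u"
  unfolding lsc_on_def by (meson at_le filter_leD subsetD)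

section \<open>Moments of the kernels\<close>

abbreviation annulus :: "real \<Rightarrow> 'a::euclidean_space set" where
  "annulus r \<equiv> ball 0 (2 * r) - ball 0 r"

lemma kernelsD:
  fixes K :: "'a::euclidean_space \<Rightarrow> real"
  assumes "K \<in> kernels s lam Lam \<rho>"
  shows "K \<in> borel_measurable borel" "0 \<le> K y"
    and "0 < r \<Longrightarrow> (\<integral>\<^sup>+ y\<in>annulus r. ennreal (K y) \<partial>lborel) \<le> ennreal (Lam * r powr (- 2 * s))"
    and "s = 1/2 \<Longrightarrow> 0 < r \<Longrightarrow> (LINT y:annulus r|lborel. K y *\<^sub>R y) = 0"
  using assms by (auto simp: kernels_def)

text \<open>
  Here \<open>\<rho> < R\<close> enters: on the scale \<open>R\<close> the truncation of the lower bound is invisible, and every kernel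
  sees every point of space with a weight comparable to the one in the tail integral.
\<close>

lemma kernel_lower_bound:
  fixes K :: "'a::euclidean_space \<Rightarrow> real"
  assumes K: "K \<in> kernels s lam Lam \<rho>" and "0 \<le> lam" "0 \<le> s" "0 \<le> \<rho>" "\<rho> < R" "y \<noteq> 0"
  shows "lam * (R + norm y) powr (- real DIM('a) - 2 * s) \<le> K y"
proof -
  let ?p = "- real DIM('a) - 2 * s"
  have p: "?p \<le> 0" using assms by simp
  have 1: "(R + norm y) powr ?p \<le> norm y powr ?p"
    using assms p by (intro powr_mono2') auto
  have 2: "(R + norm y) powr ?p \<le> \<rho> powr ?p" if "\<rho> \<noteq> 0"
    using assms p that norm_ge_zero[of y] by (intro powr_mono2') linarith+
  have "lam * (R + norm y) powr ?p \<le> lam * (if \<rho> = 0 then norm y powr ?p else min (norm y powr ?p) (\<rho> powr ?p))"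
    using 1 2 \<open>0 \<le> lam\<close> by (intro mult_left_mono) auto
  also have "\<dots> \<le> K y" using K \<open>y \<noteq> 0\<close> by (simp add: kernels_def)
  finally show ?thesis .
qed

text \<open>
  All moment estimates have the same pattern: cover the region by dyadic annuli, bound the factor \<open>f\<close> by
  a constant on each of them, and sum the bounds for the mass of the kernel.
\<close>

lemma kernel_annuli_sum:
  fixes K :: "'a::euclidean_space \<Rightarrow> real" and r b :: "nat \<Rightarrow> real"
  assumes K: "K \<in> kernels s lam Lam \<rho>" and "0 \<le> Lam"
    and S: "S \<in> sets borel" "S - {0} \<subseteq> (\<Union>n. annulus (r n))"
    and r: "\<And>n. 0 < r n"
    and f: "f \<in> borel_measurable borel" "\<And>y. 0 \<le> f y" "\<And>n y. y \<in> annulus (r n) \<Longrightarrow> f y \<le> b n"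
    and b: "\<And>n. 0 \<le> b n" "(\<lambda>n. b n * (Lam * r n powr (- 2 * s))) sums c"
  shows "set_integrable lborel S (\<lambda>y. f y * K y)" "(LINT y:S|lborel. f y * K y) \<le> c"
proof -
  have [measurable]: "K \<in> borel_measurable borel" "f \<in> borel_measurable borel" "S \<in> sets borel"
    using kernelsD(1)[OF K] f S by auto
  have [measurable]: "annulus t \<in> sets (borel :: 'a measure)" for t by simp
  have c0: "0 \<le> c"
    using b \<open>0 \<le> Lam\<close> by (intro sums_le[OF _ sums_zero b(2)]) auto
  have "(\<integral>\<^sup>+ y. ennreal (indicator S y * (f y * K y)) \<partial>lborel)
      \<le> (\<integral>\<^sup>+ y. (\<Sum>n. ennreal (b n) * (ennreal (K y) * indicator (annulus (r n)) y)) \<partial>lborel)"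
  proof (rule nn_integral_mono_AE)
    have "AE y in lborel. y \<noteq> (0::'a)"
      by (rule AE_lborel_singleton)
    then show "AE y in lborel. ennreal (indicator S y * (f y * K y))
        \<le> (\<Sum>n. ennreal (b n) * (ennreal (K y) * indicator (annulus (r n)) y))"
    proof eventually_elim
      case (elim y)
      show ?case
      proof (cases "y \<in> S")
        case True
        then obtain n where n: "y \<in> annulus (r n)" using S elim by auto
        have "ennreal (indicator S y * (f y * K y)) \<le> ennreal (b n * K y)"
          using True f(3)[OF n] kernelsD(2)[OF K] by (intro ennreal_leI) (simp add: mult_right_mono)
        also have "\<dots> = ennreal (b n) * (ennreal (K y) * indicator (annulus (r n)) y)"
          using n b(1) kernelsD(2)[OF K] by (simp add: ennreal_mult)
        also have "\<dots> = (\<Sum>i\<in>{n}. ennreal (b i) * (ennreal (K y) * indicator (annulus (r i)) y))"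
          by simp
        also have "\<dots> \<le> (\<Sum>i. ennreal (b i) * (ennreal (K y) * indicator (annulus (r i)) y))"
          by (intro sum_le_suminf) auto
        finally show ?thesis .
      qed auto
    qed
  qed
  also have "\<dots> = (\<Sum>n. ennreal (b n) * (\<integral>\<^sup>+ y\<in>annulus (r n). ennreal (K y) \<partial>lborel))"
    by (subst nn_integral_suminf) (measurable, simp add: nn_integral_cmult)
  also have "\<dots> \<le> (\<Sum>n. ennreal (b n * (Lam * r n powr (- 2 * s))))"
  proof (rule suminf_le)
    fix n
    have "ennreal (b n) * (\<integral>\<^sup>+ y\<in>annulus (r n). ennreal (K y) \<partial>lborel)
        \<le> ennreal (b n) * ennreal (Lam * r n powr (- 2 * s))"
      by (intro mult_left_mono kernelsD(3)[OF K r]) auto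
    then show "ennreal (b n) * (\<integral>\<^sup>+ y\<in>annulus (r n). ennreal (K y) \<partial>lborel)
        \<le> ennreal (b n * (Lam * r n powr (- 2 * s)))"
      using b(1) \<open>0 \<le> Lam\<close> by (simp add: ennreal_mult)
  qed auto
  also have "\<dots> = ennreal c"
    using b \<open>0 \<le> Lam\<close> sums_ennreal[of "\<lambda>n. b n * (Lam * r n powr (- 2 * s))" c] c0
    by (intro sums_unique[symmetric]) auto
  finally have le: "(\<integral>\<^sup>+ y. ennreal (indicator S y * (f y * K y)) \<partial>lborel) \<le> ennreal c" .
  have nn: "AE y in lborel. 0 \<le> indicator S y * (f y * K y)"
    using f kernelsD(2)[OF K] by simp
  have int: "integrable lborel (\<lambda>y. indicator S y * (f y * K y))"
    using nn le_less_trans[OF le] by (intro integrableI_nonneg) auto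
  then show "set_integrable lborel S (\<lambda>y. f y * K y)"
    by (simp add: set_integrable_def)
  have "ennreal (LINT y|lborel. indicator S y * (f y * K y)) \<le> ennreal c"
    using le nn_integral_eq_integral[OF int nn] by simp
  then show "(LINT y:S|lborel. f y * K y) \<le> c"
    using c0 by (simp add: set_lebesgue_integral_def)
qed

lemma dyadic_scale:
  assumes "1 \<le> (x::real)"
  obtains n :: nat where "2 ^ n \<le> x" "x < 2 ^ Suc n"
proof -
  obtain N where "x < 2 ^ N" using real_arch_pow[of 2 x] by auto
  define n where "n = (LEAST k. x < 2 ^ Suc k)"
  have ex: "x < 2 ^ Suc N" using \<open>x < 2 ^ N\<close> by (rule less_trans) simp
  have 1: "x < 2 ^ Suc n" unfolding n_def by (rule LeastI[of _ N]) (rule ex)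
  have "2 ^ n \<le> x"
  proof (cases n)
    case 0 then show ?thesis using assms by simp
  next
    case (Suc k)
    then have "\<not> x < 2 ^ Suc k" using not_less_Least[of k "\<lambda>k. x < 2 ^ Suc k"] by (simp add: n_def)
    then show ?thesis using Suc by simp
  qed
  then show ?thesis using that 1 by blast
qed

text \<open>
  The annulus of radius \<open>R 2\<^sup>-\<^sup>n\<close> contributes a multiple of \<open>(R 2\<^sup>-\<^sup>n)\<^bsup>2-2s\<^esup>\<close>, and \<open>s < 1\<close> makes this a convergent
  geometric series.
\<close>

lemma kernel_inner_moment:
  assumes "s < 1" "0 \<le> Lam"
  shows "\<exists>C\<ge>0. \<forall>lam \<rho> R. \<forall>K::'a::euclidean_space \<Rightarrow> real. K \<in> kernels s lam Lam \<rho> \<longrightarrow> 0 < R \<longrightarrow>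
     set_integrable lborel (ball 0 R) (\<lambda>y. (norm y)\<^sup>2 * K y) \<and>
     (LINT y:ball 0 R|lborel. (norm y)\<^sup>2 * K y) \<le> C * R powr (2 - 2 * s)"
proof -
  define q :: real where "q = 2 powr (2 * s - 2)"
  have q: "0 < q" "q < 1"
    using assms by (auto simp: q_def powr_less_one)
  define C where "C = 4 * Lam * q / (1 - q)"
  have "set_integrable lborel (ball 0 R) (\<lambda>y. (norm y)\<^sup>2 * K y) \<and>
     (LINT y:ball 0 R|lborel. (norm y)\<^sup>2 * K y) \<le> C * R powr (2 - 2 * s)"
    if K: "K \<in> kernels s lam Lam \<rho>" and "0 < R" for lam \<rho> R and K :: "'a \<Rightarrow> real"
  proof -
    define r where "r n = R * (1/2) ^ Suc n" for n
    have r: "0 < r n" for n using \<open>0 < R\<close> by (simp add: r_def)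
    have "ball 0 R - {0} \<subseteq> (\<Union>n. annulus (r n) :: 'a set)"
    proof
      fix y :: 'a assume y: "y \<in> ball 0 R - {0}"
      then have "1 \<le> R / norm y" by auto
      then obtain n where "2 ^ n \<le> R / norm y" "R / norm y < 2 ^ Suc n" by (rule dyadic_scale)
      then have n: "norm y \<le> R * (1/2) ^ n" "R * (1/2) ^ Suc n < norm y"
        using y by (auto simp: field_simps power_divide)
      show "y \<in> (\<Union>n. annulus (r n))"
      proof (cases "norm y = R * (1/2) ^ n")
        case True
        then obtain k where "n = Suc k" using y by (cases n) auto
        then have "norm y = r k" using True by (simp add: r_def)
        then have "y \<in> annulus (r k)" using r[of k] by simp
        then show ?thesis by blast
      next
        case False
        then have "y \<in> annulus (r n)" using n by (simp add: r_def)
        then show ?thesis by blast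
      qed
    qed
    moreover have "(norm y)\<^sup>2 \<le> 4 * (r n)\<^sup>2" if "y \<in> annulus (r n)" for n and y :: 'a
    proof -
      have "norm y \<le> 2 * r n" using that by simp
      then have "(norm y)\<^sup>2 \<le> (2 * r n)\<^sup>2" by (intro power_mono) auto
      then show ?thesis by (simp add: power2_eq_square)
    qed
    moreover have "(\<lambda>n. 4 * (r n)\<^sup>2 * (Lam * r n powr (- 2 * s))) sums (C * R powr (2 - 2 * s))"
    proof -
      have "4 * (r n)\<^sup>2 * (Lam * r n powr (- 2 * s)) = 4 * Lam * R powr (2 - 2 * s) * q * q ^ n" for n
      proof -
        have "(r n)\<^sup>2 * r n powr (- 2 * s) = r n powr (2 - 2 * s)"
          using r[of n] powr_add[of "r n" 2 "- 2 * s"] by (simp add: powr_numeral)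
        also have "\<dots> = R powr (2 - 2 * s) * ((1/2) ^ Suc n) powr (2 - 2 * s)"
          using \<open>0 < R\<close> unfolding r_def by (simp add: powr_mult del: power_Suc)
        also have "((1/2::real) ^ Suc n) powr (2 - 2 * s) = q ^ Suc n"
        proof -
          have "(1/2::real) ^ Suc n = 2 powr (- real (Suc n))"
            by (simp add: powr_minus powr_realpow power_divide field_simps del: of_nat_Suc)
          then have "((1/2::real) ^ Suc n) powr (2 - 2 * s) = 2 powr (real (Suc n) * (2 * s - 2))"
            by (simp add: powr_powr algebra_simps del: of_nat_Suc power_Suc)
          also have "\<dots> = (2 powr (2 * s - 2)) powr real (Suc n)"
            by (simp add: powr_powr mult.commute)
          also have "\<dots> = q ^ Suc n" using q(1) unfolding q_def[symmetric] by (rule powr_realpow)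
          finally show ?thesis .
        qed
        finally show ?thesis by simp
      qed
      then have "(\<lambda>n. 4 * (r n)\<^sup>2 * (Lam * r n powr (- 2 * s))) = (\<lambda>n. 4 * Lam * R powr (2 - 2 * s) * q * q ^ n)"
        by (rule ext)
      moreover have "(\<lambda>n. 4 * Lam * R powr (2 - 2 * s) * q * q ^ n) sums (4 * Lam * R powr (2 - 2 * s) * q * (1 / (1 - q)))"
        using q by (intro sums_mult geometric_sums) simp
      ultimately show ?thesis by (simp only: C_def) (simp add: mult_ac)
    qed
    ultimately show ?thesis
      using kernel_annuli_sum[OF K \<open>0 \<le> Lam\<close>, of "ball 0 R" r "\<lambda>y. (norm y)\<^sup>2" "\<lambda>n. 4 * (r n)\<^sup>2"] r
      by auto
  qed
  moreover have "0 \<le> C" using q assms by (simp add: C_def)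
  ultimately show ?thesis by blast
qed

lemma kernel_outer_moment:
  assumes "real p < 2 * s" "0 \<le> Lam"
  shows "\<exists>C\<ge>0. \<forall>lam \<rho> R. \<forall>K::'a::euclidean_space \<Rightarrow> real. K \<in> kernels s lam Lam \<rho> \<longrightarrow> 0 < R \<longrightarrow>
     set_integrable lborel (- ball 0 R) (\<lambda>y. norm y ^ p * K y) \<and>
     (LINT y:- ball 0 R|lborel. norm y ^ p * K y) \<le> C * R powr (real p - 2 * s)"
proof -
  define q :: real where "q = 2 powr (real p - 2 * s)"
  have q: "0 < q" "q < 1"
    using assms by (auto simp: q_def powr_less_one)
  define C where "C = 2 ^ p * Lam / (1 - q)"
  have "set_integrable lborel (- ball 0 R) (\<lambda>y. norm y ^ p * K y) \<and>
     (LINT y:- ball 0 R|lborel. norm y ^ p * K y) \<le> C * R powr (real p - 2 * s)"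
    if K: "K \<in> kernels s lam Lam \<rho>" and "0 < R" for lam \<rho> R and K :: "'a \<Rightarrow> real"
  proof -
    define r where "r n = R * 2 ^ n" for n :: nat
    have r: "0 < r n" for n using \<open>0 < R\<close> by (simp add: r_def)
    have "- ball 0 R - {0} \<subseteq> (\<Union>n. annulus (r n) :: 'a set)"
    proof
      fix y :: 'a assume y: "y \<in> - ball 0 R - {0}"
      then have "1 \<le> norm y / R" using \<open>0 < R\<close> by auto
      then obtain n where "2 ^ n \<le> norm y / R" "norm y / R < 2 ^ Suc n" by (rule dyadic_scale)
      then have "y \<in> annulus (r n)"
        using \<open>0 < R\<close> by (auto simp: r_def field_simps)
      then show "y \<in> (\<Union>n. annulus (r n))" by blast
    qed
    moreover have "norm y ^ p \<le> (2 * r n) ^ p" if "y \<in> annulus (r n)" for n and y :: 'a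
      using that by (intro power_mono) auto
    moreover have "(\<lambda>n. (2 * r n) ^ p * (Lam * r n powr (- 2 * s))) sums (C * R powr (real p - 2 * s))"
    proof -
      have "(2 * r n) ^ p * (Lam * r n powr (- 2 * s)) = 2 ^ p * Lam * R powr (real p - 2 * s) * q ^ n" for n
      proof -
        have "r n ^ p * r n powr (- 2 * s) = r n powr (real p - 2 * s)"
          using r[of n] powr_add[of "r n" p "- 2 * s"] by (simp add: powr_realpow)
        also have "\<dots> = R powr (real p - 2 * s) * (2 ^ n) powr (real p - 2 * s)"
          using \<open>0 < R\<close> unfolding r_def by (simp add: powr_mult)
        also have "(2 ^ n) powr (real p - 2 * s) = q ^ n"
        proof -
          have "(2 ^ n) powr (real p - 2 * s) = 2 powr (real n * (real p - 2 * s))"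
            using powr_powr[of 2 "real n" "real p - 2 * s"] by (simp add: powr_realpow)
          also have "\<dots> = (2 powr (real p - 2 * s)) powr real n"
            by (simp add: powr_powr mult.commute)
          also have "\<dots> = q ^ n" using q(1) unfolding q_def[symmetric] by (rule powr_realpow)
          finally show ?thesis .
        qed
        finally show ?thesis by (simp add: power_mult_distrib)
      qed
      then have "(\<lambda>n. (2 * r n) ^ p * (Lam * r n powr (- 2 * s))) = (\<lambda>n. 2 ^ p * Lam * R powr (real p - 2 * s) * q ^ n)"
        by (rule ext)
      moreover have "(\<lambda>n. 2 ^ p * Lam * R powr (real p - 2 * s) * q ^ n) sums (2 ^ p * Lam * R powr (real p - 2 * s) * (1 / (1 - q)))"
        using q by (intro sums_mult geometric_sums) simp
      ultimately show ?thesis by (simp only: C_def) (simp add: mult_ac)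
    qed
    ultimately show ?thesis
      using kernel_annuli_sum[OF K \<open>0 \<le> Lam\<close>, of "- ball 0 R" r "\<lambda>y. norm y ^ p" "\<lambda>n. (2 * r n) ^ p"] r
      by (auto simp: less_imp_le)
  qed
  moreover have "0 \<le> C" using q assms by (simp add: C_def)
  ultimately show ?thesis by blast
qed

lemma kernel_annulus:
  fixes K :: "'a::euclidean_space \<Rightarrow> real"
  assumes K: "K \<in> kernels s lam Lam \<rho>" and "0 \<le> Lam" "0 < r"
  shows "set_integrable lborel (annulus r) K" "(LINT y:annulus r|lborel. K y) \<le> Lam * r powr (- 2 * s)"
proof -
  have [measurable]: "K \<in> borel_measurable borel" "annulus r \<in> sets (borel :: 'a measure)"
    using kernelsD(1)[OF K] by auto
  have nn: "AE y in lborel. 0 \<le> indicator (annulus r) y * K y"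
    using kernelsD(2)[OF K] by simp
  have "(\<integral>\<^sup>+ y. ennreal (indicator (annulus r) y * K y) \<partial>lborel) = (\<integral>\<^sup>+ y\<in>annulus r. ennreal (K y) \<partial>lborel)"
    by (intro nn_integral_cong) (simp add: indicator_def)
  then have le: "(\<integral>\<^sup>+ y. ennreal (indicator (annulus r) y * K y) \<partial>lborel) \<le> ennreal (Lam * r powr (- 2 * s))"
    using kernelsD(3)[OF K \<open>0 < r\<close>] by simp
  have int: "integrable lborel (\<lambda>y. indicator (annulus r) y * K y)"
    using nn le_less_trans[OF le] by (intro integrableI_nonneg) auto
  then show "set_integrable lborel (annulus r) K" by (simp add: set_integrable_def)
  have "ennreal (LINT y|lborel. indicator (annulus r) y * K y) \<le> ennreal (Lam * r powr (- 2 * s))"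
    using le nn_integral_eq_integral[OF int nn] by simp
  then show "(LINT y:annulus r|lborel. K y) \<le> Lam * r powr (- 2 * s)"
    using \<open>0 \<le> Lam\<close> by (simp add: set_lebesgue_integral_def)
qed

text \<open>
  For \<open>s = 1/2\<close> the absolute first moment of an annulus can grow like the logarithm of \<open>b / a\<close>. The
  cancellation condition removes all complete dyadic annuli and leaves a single incomplete one.
\<close>

lemma kernel_first_moment_bound:
  fixes K :: "'a::euclidean_space \<Rightarrow> real"
  assumes K: "K \<in> kernels (1/2) lam Lam \<rho>" and "0 \<le> Lam" "0 < a" "a \<le> b"
  shows "set_integrable lborel (ball 0 b - ball 0 a) (\<lambda>y. K y *\<^sub>R y)"
    and "norm (LINT y:ball 0 b - ball 0 a|lborel. K y *\<^sub>R y) \<le> 2 * Lam"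
proof -
  have [measurable]: "K \<in> borel_measurable borel" using kernelsD(1)[OF K] .
  obtain C where "\<And>R. 0 < R \<Longrightarrow> set_integrable lborel (- ball 0 R) (\<lambda>y::'a. norm y ^ 0 * K y)"
    using kernel_outer_moment[of 0 "1/2" Lam, where 'a='a] K \<open>0 \<le> Lam\<close> by auto
  then have outer: "integrable lborel (\<lambda>y. indicator (- ball 0 R) y * K y)" if "0 < R" for R
    using that by (simp add: set_integrable_def)
  have int: "set_integrable lborel (ball 0 b - ball 0 a) (\<lambda>y. K y *\<^sub>R y)" if "0 < a" for a b
    unfolding set_integrable_def
  proof (rule Bochner_Integration.integrable_bound)
    have [measurable]: "ball 0 b - ball 0 a \<in> sets (borel :: 'a measure)" by simp
    show "(\<lambda>y. indicator (ball 0 b - ball 0 a) y *\<^sub>R K y *\<^sub>R y) \<in> borel_measurable lborel"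
      by measurable
    show "integrable lborel (\<lambda>y. b * (indicator (- ball 0 a) y * K y))"
      using outer[OF that] by simp
    show "AE y in lborel. norm (indicator (ball 0 b - ball 0 a) y *\<^sub>R K y *\<^sub>R y)
        \<le> norm (b * (indicator (- ball 0 a) y * K y))"
    proof (rule AE_I2)
      fix y :: 'a
      have "norm y * K y \<le> b * K y" if "norm y < b"
        using kernelsD(2)[OF K] that by (intro mult_right_mono) auto
      then show "norm (indicator (ball 0 b - ball 0 a) y *\<^sub>R K y *\<^sub>R y)
        \<le> norm (b * (indicator (- ball 0 a) y * K y))"
        using kernelsD(2)[OF K, of y] order_le_less_trans[OF norm_ge_zero, of y b]
        by (cases "norm y < b") (auto simp: indicator_def abs_mult mult.commute)
    qed
  qed
  show "set_integrable lborel (ball 0 b - ball 0 a) (\<lambda>y. K y *\<^sub>R y)"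
    using int \<open>0 < a\<close> .
  have "norm (LINT y:ball 0 b - ball 0 a|lborel. K y *\<^sub>R y) \<le> 2 * Lam"
    if "0 < a" "a \<le> b" "b \<le> 2 ^ n * (2 * a)" for n a
    using that
  proof (induction n arbitrary: a)
    case 0
    have "norm (LINT y:ball 0 b - ball 0 a|lborel. K y *\<^sub>R y)
        \<le> (LINT y|lborel. 2 * a * (indicator (annulus a) y * K y))"
      unfolding set_lebesgue_integral_def
    proof (rule Bochner_Integration.integral_norm_bound_integral)
      show "integrable lborel (\<lambda>y. 2 * a * (indicator (annulus a) y * K y))"
        using kernel_annulus(1)[OF K \<open>0 \<le> Lam\<close> \<open>0 < a\<close>] by (simp add: set_integrable_def)
      show "integrable lborel (\<lambda>y. indicator (ball 0 b - ball 0 a) y *\<^sub>R K y *\<^sub>R y)"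
        using int[OF \<open>0 < a\<close>] by (simp add: set_integrable_def)
      show "norm (indicator (ball 0 b - ball 0 a) y *\<^sub>R K y *\<^sub>R y)
          \<le> 2 * a * (indicator (annulus a) y * K y)" for y
        using kernelsD(2)[OF K, of y] 0
        by (auto simp: indicator_def mult.commute intro!: mult_left_mono)
    qed
    also have "\<dots> = 2 * a * (LINT y:annulus a|lborel. K y)"
      by (simp add: set_lebesgue_integral_def)
    also have "\<dots> \<le> 2 * a * (Lam * a powr (- 2 * (1/2)))"
      using kernel_annulus(2)[OF K \<open>0 \<le> Lam\<close> \<open>0 < a\<close>] 0 by (intro mult_left_mono) auto
    also have "\<dots> = 2 * Lam" using 0 by (simp add: powr_minus)
    finally show ?case .
  next
    case (Suc n)
    show ?case
    proof (cases "2 * a \<le> b")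
      case True
      have "ball 0 b - ball 0 a = (ball 0 (2 * a) - ball 0 a) \<union> (ball 0 b - ball 0 (2 * a) :: 'a set)"
        using True Suc.prems by auto
      then have "(LINT y:ball 0 b - ball 0 a|lborel. K y *\<^sub>R y)
          = (LINT y:ball 0 (2 * a) - ball 0 a|lborel. K y *\<^sub>R y) + (LINT y:ball 0 b - ball 0 (2 * a)|lborel. K y *\<^sub>R y)"
        using Suc.prems by (simp only:) (intro set_integral_Un int; auto)
      also have "(LINT y:ball 0 (2 * a) - ball 0 a|lborel. K y *\<^sub>R y) = 0"
        using kernelsD(4)[OF K] Suc.prems by simp
      finally show ?thesis using Suc.IH[of "2 * a"] Suc.prems True by simp
    next
      case False
      have "b \<le> 2 ^ n * (2 * a)"
      proof -
        have "1 * (2 * a) \<le> 2 ^ n * (2 * a)"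
          using Suc.prems by (intro mult_right_mono) auto
        then show ?thesis using False by linarith
      qed
      then show ?thesis using Suc.IH[of a] Suc.prems by simp
    qed
  qed
  moreover obtain n :: nat where "b / (2 * a) < 2 ^ n"
    using real_arch_pow[of 2 "b / (2 * a)"] by auto
  then have "b \<le> 2 ^ n * (2 * a)" using \<open>0 < a\<close> by (simp add: field_simps)
  ultimately show "norm (LINT y:ball 0 b - ball 0 a|lborel. K y *\<^sub>R y) \<le> 2 * Lam"
    using \<open>0 < a\<close> \<open>a \<le> b\<close> by blast
qed

text \<open>
  The factor with which the gradient enters \<open>delta\<close> when \<open>s \<ge> 1/2\<close>.
\<close>

definition cutoff :: "real \<Rightarrow> 'a::euclidean_space \<Rightarrow> real" where
  "cutoff s y = (if s = 1/2 then indicator (ball 0 1) y else 1)"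

lemma cutoff_measurable [measurable]: "cutoff s \<in> borel_measurable borel"
  unfolding cutoff_def by (cases "s = 1/2") (auto intro!: borel_measurable_indicator)

text \<open>
  Moving the cutoff of the gradient term to the scale \<open>R\<close> costs a term of the right scaling, whatever
  \<open>s \<ge> 1/2\<close> is: for \<open>s > 1/2\<close> because the first moment converges at infinity, for \<open>s = 1/2\<close> by
  cancellation. After this change both cases of \<open>delta\<close> can be treated together.
\<close>

lemma kernel_change_cutoff:
  assumes "1/2 \<le> s" "0 \<le> Lam"
  shows "\<exists>C\<ge>0. \<forall>lam \<rho> R D. \<forall>K::'a::euclidean_space \<Rightarrow> real. K \<in> kernels s lam Lam \<rho> \<longrightarrow> 0 < R \<longrightarrow>
     integrable lborel (\<lambda>y. (y \<bullet> D) * (cutoff s y - indicator (ball 0 R) y) * K y) \<and>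
     \<bar>LINT y|lborel. (y \<bullet> D) * (cutoff s y - indicator (ball 0 R) y) * K y\<bar> \<le> C * norm D * R powr (1 - 2 * s)"
proof (cases "s = 1/2")
  case True
  have "integrable lborel (\<lambda>y. (y \<bullet> D) * (cutoff s y - indicator (ball 0 R) y) * K y) \<and>
     \<bar>LINT y|lborel. (y \<bullet> D) * (cutoff s y - indicator (ball 0 R) y) * K y\<bar> \<le> 2 * Lam * norm D * R powr (1 - 2 * s)"
    if K: "K \<in> kernels s lam Lam \<rho>" and "0 < R" for lam \<rho> R D and K :: "'a \<Rightarrow> real"
  proof -
    \<comment> \<open>The two cutoffs differ exactly on the annulus between the radii a and b.\<close>
    define a where "a = min 1 R"
    define b where "b = max 1 R"
    define \<sigma> :: real where "\<sigma> = (if R \<le> 1 then 1 else -1)"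
    have ab: "0 < a" "a \<le> b" using \<open>0 < R\<close> by (auto simp: a_def b_def)
    define J where "J = (LINT y:ball 0 b - ball 0 a|lborel. K y *\<^sub>R y)"
    have eq: "(y \<bullet> D) * (cutoff s y - indicator (ball 0 R) y) * K y
        = \<sigma> * ((indicator (ball 0 b - ball 0 a) y *\<^sub>R K y *\<^sub>R y) \<bullet> D)" for y :: 'a
      using True by (auto simp: cutoff_def \<sigma>_def a_def b_def indicator_def min_def max_def)
    have int: "integrable lborel (\<lambda>y. indicator (ball 0 b - ball 0 a) y *\<^sub>R K y *\<^sub>R y)"
      using kernel_first_moment_bound(1)[OF K[unfolded True] \<open>0 \<le> Lam\<close> ab] by (simp add: set_integrable_def)
    have "(LINT y|lborel. \<sigma> * ((indicator (ball 0 b - ball 0 a) y *\<^sub>R K y *\<^sub>R y) \<bullet> D)) = \<sigma> * (J \<bullet> D)"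
      unfolding J_def set_lebesgue_integral_def integral_mult_right_zero
      using int by (subst integral_inner_left) auto
    moreover have "integrable lborel (\<lambda>y. \<sigma> * ((indicator (ball 0 b - ball 0 a) y *\<^sub>R K y *\<^sub>R y) \<bullet> D))"
      using int by (intro integrable_mult_right integrable_inner_left)
    moreover have "\<bar>\<sigma> * (J \<bullet> D)\<bar> \<le> 2 * Lam * norm D"
    proof -
      have "\<bar>\<sigma> * (J \<bullet> D)\<bar> \<le> norm J * norm D"
        using Cauchy_Schwarz_ineq2[of J D] by (simp add: \<sigma>_def abs_mult)
      also have "\<dots> \<le> 2 * Lam * norm D"
        unfolding J_def
        by (intro mult_right_mono kernel_first_moment_bound(2)[OF K[unfolded True] \<open>0 \<le> Lam\<close> ab]) auto
      finally show ?thesis .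
    qed
    moreover have "R powr (1 - 2 * s) = 1" unfolding True using \<open>0 < R\<close> by simp
    ultimately show ?thesis
      unfolding eq by (simp only: mult_1_right simp_thms)
  qed
  then show ?thesis using assms by (intro exI[of _ "2 * Lam"]) auto
next
  case False
  then have s: "real 1 < 2 * s" using assms by simp
  obtain C where C: "0 \<le> C" "\<And>lam \<rho> R. \<And>K::'a \<Rightarrow> real. K \<in> kernels s lam Lam \<rho> \<Longrightarrow> 0 < R \<Longrightarrow>
     set_integrable lborel (- ball 0 R) (\<lambda>y. norm y ^ 1 * K y) \<and>
     (LINT y:- ball 0 R|lborel. norm y ^ 1 * K y) \<le> C * R powr (real 1 - 2 * s)"
    using kernel_outer_moment[OF s \<open>0 \<le> Lam\<close>, where 'a='a] by blast
  have "integrable lborel (\<lambda>y. (y \<bullet> D) * (cutoff s y - indicator (ball 0 R) y) * K y) \<and>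
     \<bar>LINT y|lborel. (y \<bullet> D) * (cutoff s y - indicator (ball 0 R) y) * K y\<bar> \<le> C * norm D * R powr (1 - 2 * s)"
    if K: "K \<in> kernels s lam Lam \<rho>" and "0 < R" for lam \<rho> R D and K :: "'a \<Rightarrow> real"
  proof -
    have [measurable]: "K \<in> borel_measurable borel" using kernelsD(1)[OF K] .
    have [measurable]: "ball 0 R \<in> sets (borel :: 'a measure)" by simp
    let ?g = "\<lambda>y. norm D * (indicator (- ball 0 R) y * (norm y * K y))"
    have g: "integrable lborel ?g" "(LINT y|lborel. ?g y) \<le> C * norm D * R powr (1 - 2 * s)"
    proof -
      have i: "integrable lborel (\<lambda>y. indicator (- ball 0 R) y * (norm y * K y))"
        "(LINT y|lborel. indicator (- ball 0 R) y * (norm y * K y)) \<le> C * R powr (1 - 2 * s)"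
        using C(2)[OF K \<open>0 < R\<close>] by (simp_all add: set_integrable_def set_lebesgue_integral_def)
      then show "integrable lborel ?g" by simp
      show "(LINT y|lborel. ?g y) \<le> C * norm D * R powr (1 - 2 * s)"
        unfolding integral_mult_right_zero
        using mult_left_mono[OF i(2) norm_ge_zero[of D]] by (simp only: mult_ac)
    qed
    have le: "norm ((y \<bullet> D) * (cutoff s y - indicator (ball 0 R) y) * K y) \<le> ?g y" for y :: 'a
    proof -
      have "\<bar>y \<bullet> D\<bar> * K y \<le> norm y * norm D * K y"
        using Cauchy_Schwarz_ineq2[of y D] kernelsD(2)[OF K] by (intro mult_right_mono) auto
      then show ?thesis
        using False kernelsD(2)[OF K, of y]
        by (auto simp: cutoff_def indicator_def abs_mult mult_ac)
    qed
    have int: "integrable lborel (\<lambda>y. (y \<bullet> D) * (cutoff s y - indicator (ball 0 R) y) * K y)"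
      by (rule Bochner_Integration.integrable_bound[OF g(1)])
         (measurable, intro AE_I2 order_trans[OF le], simp)
    moreover have "\<bar>LINT y|lborel. (y \<bullet> D) * (cutoff s y - indicator (ball 0 R) y) * K y\<bar> \<le> (LINT y|lborel. ?g y)"
      using Bochner_Integration.integral_norm_bound_integral[OF int g(1) le] by simp
    ultimately show ?thesis using g(2) by linarith
  qed
  then show ?thesis using \<open>0 \<le> C\<close> by blast
qed

text \<open>
  Instead of a computation: far out the weight is dominated by a multiple of any kernel of the class, which
  has finite mass there.
\<close>

lemma weight_integrable:
  fixes K :: "'a::euclidean_space \<Rightarrow> real"
  assumes K: "K \<in> kernels s lam Lam \<rho>" and "0 < lam" "0 \<le> Lam" "0 < s" "0 \<le> \<rho>" "\<rho> < R"
  shows "integrable lborel (\<lambda>y::'a. (R + norm y) powr (- real DIM('a) - 2 * s))"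
proof -
  have [measurable]: "K \<in> borel_measurable borel" using kernelsD(1)[OF K] .
  let ?p = "- real DIM('a) - 2 * s"
  have R: "0 < R" using assms by simp
  have "set_integrable lborel (- ball 0 R) (\<lambda>y::'a. norm y ^ 0 * K y)"
    using kernel_outer_moment[of 0 s Lam, where 'a='a] K \<open>0 \<le> Lam\<close> \<open>0 < s\<close> R by auto
  then have "integrable lborel (\<lambda>y. 1 / lam * (indicator (- ball 0 R) y * K y) + R powr ?p * indicator (ball 0 R) y)"
    by (intro Bochner_Integration.integrable_add integrable_mult_right)
       (use emeasure_lborel_ball_finite[of "0::'a" R] in \<open>auto simp: set_integrable_def integrable_indicator_iff\<close>)
  then show ?thesis
  proof (rule Bochner_Integration.integrable_bound)
    show "AE y in lborel. norm ((R + norm y) powr ?p)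
      \<le> norm (1 / lam * (indicator (- ball 0 R) y * K y) + R powr ?p * indicator (ball 0 R) y)"
    proof (rule AE_I2)
      fix y :: 'a
      show "norm ((R + norm y) powr ?p)
        \<le> norm (1 / lam * (indicator (- ball 0 R) y * K y) + R powr ?p * indicator (ball 0 R) y)"
      proof (cases "y \<in> ball 0 R")
        case True
        have "(R + norm y) powr ?p \<le> R powr ?p" using R \<open>0 < s\<close> by (intro powr_mono2') auto
        then show ?thesis using True by simp
      next
        case False
        then have "y \<noteq> 0" using R by auto
        then have "lam * (R + norm y) powr ?p \<le> K y"
          using kernel_lower_bound[OF K, of R y] assms by simp
        then have "(R + norm y) powr ?p \<le> \<bar>1 / lam * K y\<bar>"
          using \<open>0 < lam\<close> kernelsD(2)[OF K, of y] by (simp add: field_simps)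
        then show ?thesis using False by (simp del: abs_mult)
      qed
    qed
  qed measurable
qed

section \<open>The spatial profile\<close>

text \<open>
  The square of the positive part is chosen for its convexity: \<open>z \<mapsto> (max 0 z)\<^sup>2\<close> lies above its
  tangents, so that the second differences are bounded below by minus a multiple of the first power of
  \<open>1 - |x|\<^sup>2/R\<^sup>2\<close> (see \<open>bump_expansion\<close>), which also controls the gradient.
\<close>

definition bump :: "real \<Rightarrow> 'a::euclidean_space \<Rightarrow> real" where
  "bump R x = (max 0 (1 - (norm x)\<^sup>2 / R\<^sup>2))\<^sup>2"

definition bump_grad :: "real \<Rightarrow> 'a::euclidean_space \<Rightarrow> 'a" where
  "bump_grad R x = - (4 * (1 - (norm x)\<^sup>2 / R\<^sup>2) / R\<^sup>2) *\<^sub>R x"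

lemma bump_range: "0 \<le> bump R x" "bump R x \<le> 1"
  unfolding bump_def by (auto intro!: power_le_one)

lemma bump_outside: "0 < R \<Longrightarrow> R \<le> norm x \<Longrightarrow> bump R x = 0"
  by (simp add: bump_def power_mono)

lemma continuous_on_bump [continuous_intros]:
  "continuous_on S f \<Longrightarrow> continuous_on S (\<lambda>x. bump R (f x))"
  unfolding bump_def divide_inverse by (intro continuous_intros)

lemma borel_measurable_bump [measurable]: "bump R \<in> borel_measurable borel"
  by (intro borel_measurable_continuous_onI continuous_on_bump continuous_on_id)

lemma bump_half_ball: "0 < R \<Longrightarrow> norm x \<le> R / 2 \<Longrightarrow> 3/4 \<le> 1 - (norm x)\<^sup>2 / R\<^sup>2"
  using power_mono[of "norm x" "R / 2" 2] by (simp add: field_simps power_divide)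

lemma inside_ball_pos:
  assumes "x \<in> ball 0 R"
  shows "0 < 1 - (norm x)\<^sup>2 / R\<^sup>2" "1 - (norm x)\<^sup>2 / R\<^sup>2 \<le> 1"
proof -
  have "norm x < R" using assms by simp
  moreover have "0 < R" using \<open>norm x < R\<close> norm_ge_zero[of x] by linarith
  ultimately show "0 < 1 - (norm x)\<^sup>2 / R\<^sup>2" by (simp add: power_strict_mono)
qed simp

lemma GDERIV_bump:
  assumes "x \<in> ball 0 R"
  shows "GDERIV (bump R) x :> bump_grad R x"
proof -
  define c where "c = 1 / R\<^sup>2"
  have "((\<lambda>x. (1 - c * (x \<bullet> x))\<^sup>2) has_derivative (\<lambda>h. 2 * (1 - c * (x \<bullet> x)) * (- c * (2 * (h \<bullet> x))))) (at x)"
    by (auto intro!: derivative_eq_intros simp: inner_commute algebra_simps)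
  moreover have "2 * (1 - c * (x \<bullet> x)) * (- c * (2 * (h \<bullet> x))) = h \<bullet> bump_grad R x" for h
    by (simp add: bump_grad_def c_def power2_norm_eq_inner)
  ultimately have "((\<lambda>x. (1 - c * (x \<bullet> x))\<^sup>2) has_derivative (\<lambda>h. h \<bullet> bump_grad R x)) (at x)"
    by simp
  then have "(bump R has_derivative (\<lambda>h. h \<bullet> bump_grad R x)) (at x)"
  proof (rule has_derivative_transform_within_open[of _ _ _ _ "ball 0 R"])
    show "(1 - c * (y \<bullet> y))\<^sup>2 = bump R y" if "y \<in> ball 0 R" for y :: 'a
      using inside_ball_pos(1)[OF that] by (simp add: bump_def c_def power2_norm_eq_inner max_def)
  qed (use assms in auto)
  then show ?thesis by (simp add: gderiv_def)
qed

text \<open>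
  With \<open>q = 1 - |x|\<^sup>2/R\<^sup>2\<close>, the linear part of \<open>q (x0 + y) - q x0\<close> accounts for the gradient term and its
  quadratic part for the term \<open>-2 q x0 |y|\<^sup>2/R\<^sup>2\<close>. What is left is the gap between \<open>z \<mapsto> (max 0 z)\<^sup>2\<close> and
  its tangent at \<open>q x0\<close>, which is nonnegative and equals \<open>(q (x0 + y) - q x0)\<^sup>2\<close> where \<open>q (x0 + y) \<ge> 0\<close>.
\<close>

lemma bump_expansion:
  fixes x0 y :: "'a::euclidean_space" and R :: real
  defines "q \<equiv> \<lambda>x::'a. 1 - (norm x)\<^sup>2 / R\<^sup>2"
  assumes x0: "x0 \<in> ball 0 R"
  defines "E \<equiv> bump R (x0 + y) - bump R x0 - y \<bullet> bump_grad R x0"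
  shows "E \<ge> - (2 * q x0 * (norm y)\<^sup>2 / R\<^sup>2)"
    and "0 \<le> q (x0 + y) \<Longrightarrow> E = - (2 * q x0 * (norm y)\<^sup>2 / R\<^sup>2) + (q (x0 + y) - q x0)\<^sup>2"
    and "norm y < R \<Longrightarrow> E \<le> 9 * (norm y)\<^sup>2 / R\<^sup>2"
proof -
  have q0: "0 < q x0" unfolding q_def using inside_ball_pos(1)[OF x0] .
  have R: "0 < R" using x0 norm_ge_zero[of x0] by (simp del: norm_ge_zero)
  have z: "q (x0 + y) - q x0 = - (2 * (x0 \<bullet> y) + (norm y)\<^sup>2) / R\<^sup>2"
    unfolding q_def power2_norm_eq_inner
    by (simp add: inner_add inner_commute diff_divide_distrib add_divide_distrib)
  have "y \<bullet> bump_grad R x0 = - (4 * q x0 * (x0 \<bullet> y)) / R\<^sup>2"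
    by (simp add: bump_grad_def q_def inner_commute)
  also have "\<dots> = 2 * q x0 * (q (x0 + y) - q x0) + 2 * q x0 * (norm y)\<^sup>2 / R\<^sup>2"
    unfolding z using R by (simp add: field_simps)
  finally have lin: "y \<bullet> bump_grad R x0 = 2 * q x0 * (q (x0 + y) - q x0) + 2 * q x0 * (norm y)\<^sup>2 / R\<^sup>2" .
  have E: "E = (max 0 (q (x0 + y)))\<^sup>2 - (q x0)\<^sup>2 - 2 * q x0 * (q (x0 + y) - q x0) - 2 * q x0 * (norm y)\<^sup>2 / R\<^sup>2"
  proof -
    have "bump R x = (max 0 (q x))\<^sup>2" for x by (simp add: bump_def q_def)
    moreover have "max 0 (q x0) = q x0" using q0 by simp
    ultimately show ?thesis
      unfolding E_def lin by simp
  qed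
  show eq: "E = - (2 * q x0 * (norm y)\<^sup>2 / R\<^sup>2) + (q (x0 + y) - q x0)\<^sup>2" if "0 \<le> q (x0 + y)"
    using that unfolding E by (simp add: max_def power2_eq_square algebra_simps)
  have neg: "(max 0 (q (x0 + y)))\<^sup>2 - (q x0)\<^sup>2 - 2 * q x0 * (q (x0 + y) - q x0) = (q x0)\<^sup>2 - 2 * q x0 * q (x0 + y)"
    if "q (x0 + y) < 0"
    using that by (simp add: max_def power2_eq_square algebra_simps)
  show "E \<ge> - (2 * q x0 * (norm y)\<^sup>2 / R\<^sup>2)"
  proof (cases "0 \<le> q (x0 + y)")
    case True then show ?thesis using eq by simp
  next
    case False
    then have "q x0 * q (x0 + y) \<le> 0" using q0 by (intro mult_nonneg_nonpos) auto
    moreover have "2 * q x0 * q (x0 + y) = 2 * (q x0 * q (x0 + y))" by simp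
    ultimately have "0 \<le> (q x0)\<^sup>2 - 2 * q x0 * q (x0 + y)"
      using zero_le_power2[of "q x0"] by linarith
    then show ?thesis using neg False unfolding E by linarith
  qed
  show "E \<le> 9 * (norm y)\<^sup>2 / R\<^sup>2" if y: "norm y < R"
  proof -
    have "(max 0 (q (x0 + y)))\<^sup>2 - (q x0)\<^sup>2 - 2 * q x0 * (q (x0 + y) - q x0) \<le> (q (x0 + y) - q x0)\<^sup>2"
    proof (cases "0 \<le> q (x0 + y)")
      case True then show ?thesis by (simp add: max_def power2_eq_square algebra_simps)
    next
      case False
      then show ?thesis using neg by (simp add: power2_eq_square algebra_simps)
    qed
    moreover have "0 \<le> 2 * q x0 * (norm y)\<^sup>2 / R\<^sup>2" using q0 by simp
    ultimately have "E \<le> (q (x0 + y) - q x0)\<^sup>2" unfolding E by linarith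
    also have "\<dots> \<le> (3 * norm y / R)\<^sup>2"
    proof -
      have "\<bar>2 * (x0 \<bullet> y) + (norm y)\<^sup>2\<bar> \<le> 2 * (norm x0 * norm y) + norm y * norm y"
        using Cauchy_Schwarz_ineq2[of x0 y] by (auto simp: power2_eq_square intro: abs_triangle_ineq[THEN order_trans])
      also have "\<dots> \<le> 2 * (R * norm y) + R * norm y"
        using x0 y by (intro add_mono mult_left_mono mult_right_mono) auto
      finally have "\<bar>2 * (x0 \<bullet> y) + (norm y)\<^sup>2\<bar> \<le> 3 * norm y / R * R\<^sup>2"
        using R by (simp add: power2_eq_square mult.commute)
      then have "\<bar>q (x0 + y) - q x0\<bar> \<le> 3 * norm y / R"
        unfolding z using R by (simp add: divide_le_eq abs_minus_commute)
      then show ?thesis using power_mono[of "\<bar>q (x0 + y) - q x0\<bar>" _ 2] by simp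
    qed
    finally show ?thesis by (simp add: power_divide power_mult_distrib)
  qed
qed

lemma norm_bump_grad_le:
  fixes x :: "'a::euclidean_space"
  assumes "x \<in> ball 0 R"
  shows "norm (bump_grad R x) \<le> 4 * (1 - (norm x)\<^sup>2 / R\<^sup>2) / R"
proof -
  have R: "0 < R" "norm x \<le> R" using assms norm_ge_zero[of x] by (auto simp del: norm_ge_zero)
  have "norm (bump_grad R x) = 4 * (1 - (norm x)\<^sup>2 / R\<^sup>2) / R\<^sup>2 * norm x"
    using inside_ball_pos(1)[OF assms] by (simp add: bump_grad_def abs_mult)
  also have "\<dots> \<le> 4 * (1 - (norm x)\<^sup>2 / R\<^sup>2) / R\<^sup>2 * R"
    using R inside_ball_pos(1)[OF assms]
    by (intro mult_left_mono divide_nonneg_nonneg mult_nonneg_nonneg) auto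
  also have "\<dots> = 4 * (1 - (norm x)\<^sup>2 / R\<^sup>2) / R" using R by (simp add: power2_eq_square)
  finally show ?thesis .
qed

lemma lipschitz_bump_grad:
  assumes "0 < R"
  shows "(12 / R\<^sup>2)-lipschitz_on (ball (0::'a::euclidean_space) R) (bump_grad R)"
proof (rule lipschitz_onI)
  fix x y :: 'a assume xy: "x \<in> ball 0 R" "y \<in> ball 0 R"
  let ?q = "\<lambda>x::'a. 1 - (norm x)\<^sup>2 / R\<^sup>2"
  have "\<bar>?q x - ?q y\<bar> = \<bar>norm x - norm y\<bar> * (norm x + norm y) / R\<^sup>2"
    by (simp add: diff_divide_distrib[symmetric] power2_eq_square square_diff_square_factored abs_mult mult.commute abs_minus_commute)
  also have "\<dots> \<le> norm (x - y) * (2 * R) / R\<^sup>2"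
    using xy norm_triangle_ineq3[of x y] by (intro divide_right_mono mult_mono) auto
  finally have q: "\<bar>?q x - ?q y\<bar> \<le> 2 * norm (x - y) / R"
    using assms by (simp add: power2_eq_square mult.commute)
  have "?q x *\<^sub>R x - ?q y *\<^sub>R y = ?q x *\<^sub>R (x - y) + (?q x - ?q y) *\<^sub>R y"
    by (simp only: scaleR_right_diff_distrib scaleR_left_diff_distrib) simp
  then have "- (4 / R\<^sup>2) *\<^sub>R (?q x *\<^sub>R x - ?q y *\<^sub>R y) = - (4 / R\<^sup>2) *\<^sub>R (?q x *\<^sub>R (x - y) + (?q x - ?q y) *\<^sub>R y)"
    by (simp only:)
  moreover have "bump_grad R x - bump_grad R y = - (4 / R\<^sup>2) *\<^sub>R (?q x *\<^sub>R x - ?q y *\<^sub>R y)"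
    unfolding bump_grad_def scaleR_right_diff_distrib by simp
  ultimately have "bump_grad R x - bump_grad R y = - (4 / R\<^sup>2) *\<^sub>R (?q x *\<^sub>R (x - y) + (?q x - ?q y) *\<^sub>R y)"
    by simp
  then have "norm (bump_grad R x - bump_grad R y) = 4 / R\<^sup>2 * norm (?q x *\<^sub>R (x - y) + (?q x - ?q y) *\<^sub>R y)"
    by simp
  also have "\<dots> \<le> 4 / R\<^sup>2 * (1 * norm (x - y) + 2 * norm (x - y) / R * R)"
  proof (intro mult_left_mono norm_triangle_le add_mono)
    show "norm (?q x *\<^sub>R (x - y)) \<le> 1 * norm (x - y)"
      using inside_ball_pos[OF xy(1)] unfolding norm_scaleR by (intro mult_right_mono) auto
    show "norm ((?q x - ?q y) *\<^sub>R y) \<le> 2 * norm (x - y) / R * R"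
      unfolding norm_scaleR using q xy assms by (intro mult_mono) auto
  qed auto
  also have "\<dots> = 12 / R\<^sup>2 * dist x y" using assms by (simp add: dist_norm)
  finally show "dist (bump_grad R x) (bump_grad R y) \<le> 12 / R\<^sup>2 * dist x y" by (simp add: dist_norm)
qed auto

section \<open>The nonlocal operator at a point of contact\<close>

lemma gradient_eqI: "GDERIV w x :> D \<Longrightarrow> gradient w x = D"
proof -
  have "D' = D" if "GDERIV w x :> D'" "GDERIV w x :> D" for D' D :: 'a
    using has_derivative_unique[OF that[unfolded gderiv_def]] by (metis inner_commute vector_eq_ldot)
  then show "GDERIV w x :> D \<Longrightarrow> gradient w x = D"
    unfolding gradient_def by blast
qed

lemma delta_cutoff:
  "1/2 \<le> s \<Longrightarrow> delta s y w x = w (x + y) - w x - (y \<bullet> gradient w x) * cutoff s y"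
  by (auto simp: delta_def cutoff_def)

lemma pos_powr_split:
  fixes R :: real
  assumes "0 < R"
  shows "R powr (2 - 2 * s) = R\<^sup>2 * R powr (- 2 * s)" "R powr (1 - 2 * s) = R * R powr (- 2 * s)"
    and "R ^ n * R powr (- real n - 2 * s) = R powr (- 2 * s)"
  using assms powr_add[of R 2 "- 2 * s"] powr_add[of R 1 "- 2 * s"] powr_add[of R "real n" "- real n - 2 * s"]
  by (simp_all add: powr_numeral powr_realpow)

text \<open>
  Write \<open>v = (M \<cdot> bump - b) + H\<close> with \<open>H \<ge> 0\<close>. The difference of the first part is at least \<open>-M q0\<close> times
  a function of finite moment, and if \<open>q0 \<le> 1/4\<close> it gains a fixed amount whenever \<open>x0 + y\<close> lies in the
  half ball, where the bump is much larger than at \<open>x0\<close>. The excess \<open>H\<close> is integrated against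
  \<open>c (R + |y|)\<^bsup>-P\<^esup>\<close> instead of \<open>K\<close>; outside \<open>B\<^sub>\<epsilon>(x0)\<close> it is at least \<open>U - M \<cdot> bump\<close>, which yields the
  tail integral of \<open>U\<close> and the loss \<open>c \<beta>\<close>. The constant \<open>c\<close> stays free so that this loss can be made
  smaller than the gain.
\<close>

lemma L_op_touching_lower_bound:
  fixes K U :: "'a::euclidean_space \<Rightarrow> real" and x0 :: 'a and s R M b \<epsilon> :: real
  defines "\<beta> \<equiv> measure lborel (ball (0::'a) 1)" and "P \<equiv> real DIM('a) + 2 * s"
  assumes par: "1/2 \<le> s" "s < 1" "0 < lam" "0 \<le> Lam" "0 \<le> \<rho>" "\<rho> < R"
    and K: "K \<in> kernels s lam Lam \<rho>"
    and x0: "x0 \<in> ball 0 R" and M: "0 \<le> M" and b: "0 \<le> b" and \<epsilon>: "0 < \<epsilon>"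
    and U: "U \<in> borel_measurable borel" "\<And>x. 0 \<le> U x" "\<And>x. U x \<le> B"
    and below: "\<And>x. M * bump R x - b \<le> U x"
    and c: "0 \<le> c" "c \<le> lam"
    and inner: "set_integrable lborel (ball 0 R) (\<lambda>y. (norm y)\<^sup>2 * K y)"
      "(LINT y:ball 0 R|lborel. (norm y)\<^sup>2 * K y) \<le> C1 * R powr (2 - 2 * s)"
    and outer: "set_integrable lborel (- ball 0 R) K" "(LINT y:- ball 0 R|lborel. K y) \<le> C2 * R powr (- 2 * s)"
    and cut: "\<And>D. integrable lborel (\<lambda>y. (y \<bullet> D) * (cutoff s y - indicator (ball 0 R) y) * K y)"
      "\<And>D. \<bar>LINT y|lborel. (y \<bullet> D) * (cutoff s y - indicator (ball 0 R) y) * K y\<bar> \<le> C3 * norm D * R powr (1 - 2 * s)"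
      "0 \<le> C3"
  defines "v \<equiv> \<lambda>x. if x \<in> ball x0 \<epsilon> then M * bump R x - b else U x"
    and "q0 \<equiv> 1 - (norm x0)\<^sup>2 / R\<^sup>2"
  shows "gradient v x0 = M *\<^sub>R bump_grad R x0"
    and "L_op s K v x0 \<ge> c * (LINT y|lborel. indicator (- ball 0 \<epsilon>) y * U (x0 + y) * (R + norm y) powr (- P))
      + M * R powr (- 2 * s) * ((if q0 \<le> 1/4 then lam * \<beta> * 3 powr (- P) / (4 * 2 ^ DIM('a)) else 0)
          - (2 * C1 + C2 + 4 * C3) * q0 - c * \<beta>)"
proof -
  have Km [measurable]: "K \<in> borel_measurable borel" and K0: "\<And>y. 0 \<le> K y"
    using kernelsD[OF K] by auto
  note U(1) [measurable]
  have bm [measurable]: "ball z r \<in> sets (borel :: 'a measure)" for z r by simp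
  have R: "0 < R" using par by simp
  have q0: "0 < q0" "q0 \<le> 1" using inside_ball_pos[OF x0] by (simp_all add: q0_def)
  have bump_x0: "bump R x0 = q0\<^sup>2" using q0 by (simp add: bump_def q0_def)
  define G where "G = M *\<^sub>R bump_grad R x0"
  have "GDERIV (\<lambda>x. M * bump R x - b) x0 :> G"
    using GDERIV_bump[OF x0] unfolding gderiv_def G_def
    by (auto intro!: derivative_eq_intros simp: inner_commute)
  then have "GDERIV v x0 :> G"
    unfolding gderiv_def
    by (rule has_derivative_transform_within_open[where s="ball x0 \<epsilon>"]) (use \<epsilon> in \<open>auto simp: v_def\<close>)
  then have grad: "gradient v x0 = G" by (rule gradient_eqI)
  then show "gradient v x0 = M *\<^sub>R bump_grad R x0" by (simp add: G_def)

  have vm [measurable]: "v \<in> borel_measurable borel" unfolding v_def by measurable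
  define e where "e y = v (x0 + y) - v x0 - (y \<bullet> G) * indicator (ball 0 R) y" for y
  have em [measurable]: "e \<in> borel_measurable borel" unfolding e_def by measurable
  have v_x0: "v x0 = M * bump R x0 - b" using \<epsilon> by (simp add: v_def)
  have in_eps: "x0 + y \<in> ball x0 \<epsilon> \<longleftrightarrow> norm y < \<epsilon>" for y by (simp add: dist_norm)
  have B: "0 \<le> B" using U(2,3)[of 0] by linarith

  \<comment> \<open>The pieces of the integrand: the second moment near the origin and the mass far away.\<close>
  define a1 where "a1 y = indicator (ball 0 R) y * ((norm y)\<^sup>2 * K y)" for y
  define a2 where "a2 y = indicator (- ball 0 R) y * K y" for y
  have a1: "integrable lborel a1" "(LINT y|lborel. a1 y) \<le> C1 * (R\<^sup>2 * R powr (- 2 * s))"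
    using inner pos_powr_split(1)[OF R, of s] unfolding a1_def set_integrable_def set_lebesgue_integral_def by simp_all
  have a2: "integrable lborel a2" "(LINT y|lborel. a2 y) \<le> C2 * R powr (- 2 * s)"
    using outer unfolding a2_def set_integrable_def set_lebesgue_integral_def by simp_all
  have a0: "0 \<le> a1 y" "0 \<le> a2 y" for y using K0 by (auto simp: a1_def a2_def)

  define E where "E y = bump R (x0 + y) - bump R x0 - y \<bullet> bump_grad R x0" for y
  have E_low: "- (2 * q0 * (norm y)\<^sup>2 / R\<^sup>2) \<le> E y" for y
    using bump_expansion(1)[OF x0, of y] by (simp add: E_def q0_def)
  have E_up: "\<bar>E y\<bar> \<le> 9 / R\<^sup>2 * (norm y)\<^sup>2" if "norm y < R" for y
  proof -
    have "2 * q0 * (norm y)\<^sup>2 / R\<^sup>2 \<le> 9 / R\<^sup>2 * (norm y)\<^sup>2"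
      using q0 by (auto simp: divide_simps intro: mult_right_mono)
    then show ?thesis
      using E_low[of y] bump_expansion(3)[OF x0 that] by (simp add: E_def abs_le_iff)
  qed

  define C0 where "C0 = 2 * (B + M + b) + R * norm G"
  have C0: "0 \<le> C0" using B M b R by (simp add: C0_def)
  have v_bd: "\<bar>v x\<bar> \<le> B + M + b" for x
  proof -
    have "\<bar>M * bump R x - b\<bar> \<le> M + b"
      using bump_range[of R x] M b mult_left_mono[of "bump R x" 1 M] mult_nonneg_nonneg[of M "bump R x"] by linarith
    then show ?thesis using U(2,3)[of x] B M b by (auto simp: v_def)
  qed
  \<comment> \<open>Absolute convergence, without which the Bochner integral would be 0 by default. Within B_\<epsilon>(x0) the
    function v is a multiple of the bump up to a constant, so the differences are quadratic there; beyond it v is bounded.\<close>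
  have e_bd: "\<bar>e y * K y\<bar> \<le> (9 * M / R\<^sup>2 + C0 / \<epsilon>\<^sup>2) * a1 y + C0 * a2 y" for y
  proof -
    have far: "\<bar>e y\<bar> \<le> C0"
    proof -
      have "\<bar>(y \<bullet> G) * indicator (ball 0 R) y\<bar> \<le> R * norm G"
      proof (cases "norm y < R")
        case True
        then have "norm y * norm G \<le> R * norm G" by (intro mult_right_mono) auto
        then show ?thesis using True Cauchy_Schwarz_ineq2[of y G] by simp
      qed (use R in auto)
      then have sum: "\<bar>v (x0 + y)\<bar> + \<bar>v x0\<bar> + \<bar>(y \<bullet> G) * indicator (ball 0 R) y\<bar>
          \<le> (B + M + b) + (B + M + b) + R * norm G"
        by (intro add_mono v_bd)
      have "\<bar>e y\<bar> \<le> \<bar>v (x0 + y)\<bar> + \<bar>v x0\<bar> + \<bar>(y \<bullet> G) * indicator (ball 0 R) y\<bar>"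
        unfolding e_def by arith
      also note sum
      also have "(B + M + b) + (B + M + b) + R * norm G = C0" by (simp add: C0_def)
      finally show ?thesis .
    qed
    show ?thesis
    proof (cases "norm y < R")
      case False
      then have "\<bar>e y * K y\<bar> \<le> C0 * a2 y"
        using far K0[of y] by (simp add: a2_def abs_mult mult_right_mono)
      moreover have "0 \<le> (9 * M / R\<^sup>2 + C0 / \<epsilon>\<^sup>2) * a1 y" using a0 M C0 by simp
      ultimately show ?thesis by linarith
    next
      case True
      have "\<bar>e y\<bar> \<le> (9 * M / R\<^sup>2 + C0 / \<epsilon>\<^sup>2) * (norm y)\<^sup>2"
      proof (cases "norm y < \<epsilon>")
        case near: True
        have "e y = M * E y"
          using True near in_eps[of y] v_x0 unfolding e_def E_def G_def v_def
          by (simp add: algebra_simps)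
        then have "\<bar>e y\<bar> \<le> M * (9 / R\<^sup>2 * (norm y)\<^sup>2)"
          using mult_left_mono[OF E_up[OF True] M] M by (simp add: abs_mult)
        moreover have "0 \<le> C0 / \<epsilon>\<^sup>2 * (norm y)\<^sup>2" using C0 by simp
        ultimately show ?thesis by (simp add: algebra_simps)
      next
        case False
        then have "1 \<le> (norm y)\<^sup>2 / \<epsilon>\<^sup>2" using \<epsilon> by (simp add: power_mono)
        then have "\<bar>e y\<bar> \<le> C0 * ((norm y)\<^sup>2 / \<epsilon>\<^sup>2)"
          using far mult_left_mono[OF _ C0, of 1 "(norm y)\<^sup>2 / \<epsilon>\<^sup>2"] by simp
        moreover have "0 \<le> 9 * M / R\<^sup>2 * (norm y)\<^sup>2" using M by simp
        ultimately show ?thesis by (simp add: algebra_simps)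
      qed
      then have "\<bar>e y * K y\<bar> \<le> (9 * M / R\<^sup>2 + C0 / \<epsilon>\<^sup>2) * (norm y)\<^sup>2 * K y"
        using K0[of y] by (simp add: abs_mult mult_right_mono)
      then show ?thesis using True by (simp add: a1_def a2_def mult.assoc)
    qed
  qed
  have e_int: "integrable lborel (\<lambda>y. e y * K y)"
  proof (rule Bochner_Integration.integrable_bound)
    show "integrable lborel (\<lambda>y. (9 * M / R\<^sup>2 + C0 / \<epsilon>\<^sup>2) * a1 y + C0 * a2 y)"
      using a1(1) a2(1) by simp
    show "AE y in lborel. norm (e y * K y) \<le> norm ((9 * M / R\<^sup>2 + C0 / \<epsilon>\<^sup>2) * a1 y + C0 * a2 y)"
      unfolding real_norm_def by (intro AE_I2 order_trans[OF e_bd abs_ge_self])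
  qed measurable
  have "L_op s K v x0 = (LINT y|lborel. e y * K y - (y \<bullet> G) * (cutoff s y - indicator (ball 0 R) y) * K y)"
    unfolding L_op_def delta_cutoff[OF par(1)] grad e_def by (simp add: algebra_simps)
  also have "\<dots> = (LINT y|lborel. e y * K y) - (LINT y|lborel. (y \<bullet> G) * (cutoff s y - indicator (ball 0 R) y) * K y)"
    using e_int cut(1) by (rule Bochner_Integration.integral_diff)
  also have "\<dots> \<ge> (LINT y|lborel. e y * K y) - 4 * C3 * M * q0 * R powr (- 2 * s)"
  proof -
    have "norm G \<le> M * (4 * q0 / R)"
      using mult_left_mono[OF norm_bump_grad_le[OF x0] M] M by (simp add: G_def q0_def)
    then have "C3 * norm G * R powr (1 - 2 * s) \<le> C3 * (M * (4 * q0 / R)) * R powr (1 - 2 * s)"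
      using cut(3) by (intro mult_right_mono mult_left_mono) auto
    also have "\<dots> = 4 * C3 * M * q0 * R powr (- 2 * s)"
      using R unfolding pos_powr_split(2)[OF R] by simp
    finally show ?thesis using cut(2)[of G] by linarith
  qed
  finally have L1: "L_op s K v x0 \<ge> (LINT y|lborel. e y * K y) - 4 * C3 * M * q0 * R powr (- 2 * s)" .

  \<comment> \<open>One quarter is a lower bound for the square of 3/4 - q0 when q0 is at most 1/4.\<close>
  define g :: real where "g = (if q0 \<le> 1/4 then 1/4 else 0)"
  have g0: "0 \<le> g" by (simp add: g_def)
  define k where "k y = (R + norm y) powr (- P)" for y :: 'a
  have km [measurable]: "k \<in> borel_measurable borel" unfolding k_def by measurable
  have k0: "0 \<le> k y" for y by (simp add: k_def)
  have Pneg: "- P \<le> 0" using par by (simp add: P_def)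
  have k_int: "integrable lborel k"
  proof -
    have "- P = - real DIM('a) - 2 * s" by (simp add: P_def)
    then show ?thesis unfolding k_def using weight_integrable[OF K, of R] par by simp
  qed
  define a3 where "a3 y = (indicator (ball (- x0) (R/2)) y :: real)" for y
  define a4 where "a4 y = (indicator (ball (- x0) R) y :: real)" for y
  define a5 where "a5 y = indicator (- ball 0 \<epsilon>) y * U (x0 + y) * k y" for y
  have mball: "measure lborel (ball z r) = r ^ DIM('a) * \<beta>" if "0 \<le> r" for z :: 'a and r
    unfolding \<beta>_def using content_ball_conv_unit_ball[OF that] .
  have int_ball: "integrable lborel (indicator (ball z r) :: 'a \<Rightarrow> real)" for z :: 'a and r
    using emeasure_lborel_ball_finite[of z r] by (simp add: integrable_indicator_iff)
  have a3: "integrable lborel a3" "(LINT y|lborel. a3 y) = (R/2) ^ DIM('a) * \<beta>"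
    using int_ball mball[of "R/2" "- x0"] R unfolding a3_def by simp_all
  have a4: "integrable lborel a4" "(LINT y|lborel. a4 y) = R ^ DIM('a) * \<beta>"
    using int_ball mball[of R "- x0"] R unfolding a4_def by simp_all
  have a5: "integrable lborel a5"
  proof (rule Bochner_Integration.integrable_bound)
    show "integrable lborel (\<lambda>y. B * k y)" using k_int by simp
    show "AE y in lborel. norm (a5 y) \<le> norm (B * k y)"
    proof (rule AE_I2)
      fix y
      have "U (x0 + y) * k y \<le> B * k y" using U(3) k0 by (intro mult_right_mono)
      then show "norm (a5 y) \<le> norm (B * k y)"
        using U(2)[of "x0 + y"] k0[of y] B by (simp add: a5_def indicator_def)
    qed
    show "a5 \<in> borel_measurable lborel" unfolding a5_def by measurable
  qed
  \<comment> \<open>A minorant of the integrand that can be integrated term by term. The comparison fails at the origin, where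
    the kernel has no lower bound.\<close>
  define F where "F y = - (2 * M * q0 / R\<^sup>2) * a1 y - M * q0 * a2 y + M * g * lam * (3 * R) powr (- P) * a3 y
      - c * M * R powr (- P) * a4 y + c * a5 y" for y
  have F_int: "integrable lborel F"
    unfolding F_def using a1 a2 a3 a4 a5 by simp
  have F_le: "F y \<le> e y * K y" if "y \<noteq> 0" for y
  proof -
    define H where "H = v (x0 + y) - (M * bump R (x0 + y) - b)"
    have H0: "0 \<le> H" using below by (simp add: H_def v_def)
    have H1: "indicator (- ball 0 \<epsilon>) y * U (x0 + y) - M * bump R (x0 + y) \<le> H"
      using b M bump_range(1)[of R "x0 + y"] in_eps[of y]
      by (cases "norm y < \<epsilon>") (auto simp: H_def v_def)
    have Kk: "lam * k y \<le> K y"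
    proof -
      have "- P = - real DIM('a) - 2 * s" by (simp add: P_def)
      then show ?thesis
        unfolding k_def using kernel_lower_bound[OF K, of R y] par \<open>y \<noteq> 0\<close> by simp
    qed
    have e_eq: "e y = M * (bump R (x0 + y) - bump R x0 - (y \<bullet> bump_grad R x0) * indicator (ball 0 R) y) + H"
      unfolding e_def H_def v_x0 G_def by (simp add: algebra_simps)
    have in_half: "norm (x0 + y) < R/2 \<longleftrightarrow> y \<in> ball (- x0) (R/2)" and in_R: "norm (x0 + y) < R \<longleftrightarrow> y \<in> ball (- x0) R"
      by (simp_all add: dist_norm norm_minus_commute[of "-x0"] add.commute)
    have q0sq: "q0\<^sup>2 \<le> q0" using q0 by (simp add: power2_eq_square mult_left_le)
    have main: "- (2 * q0 / R\<^sup>2) * (indicator (ball 0 R) y * (norm y)\<^sup>2) - q0 * indicator (- ball 0 R) y + g * a3 y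
        \<le> bump R (x0 + y) - bump R x0 - (y \<bullet> bump_grad R x0) * indicator (ball 0 R) y"
    proof (cases "norm y < R")
      case True
      have "- (2 * q0 * (norm y)\<^sup>2 / R\<^sup>2) + g * a3 y \<le> E y"
      proof (cases "q0 \<le> 1/4 \<and> norm (x0 + y) < R/2")
        case True
        define z where "z = 1 - (norm (x0 + y))\<^sup>2 / R\<^sup>2"
        have z: "3/4 \<le> z" using bump_half_ball[OF R, of "x0 + y"] True by (simp add: z_def)
        then have "(1/2)\<^sup>2 \<le> (z - q0)\<^sup>2" using True by (intro power_mono) auto
        moreover have "E y = - (2 * q0 * (norm y)\<^sup>2 / R\<^sup>2) + (z - q0)\<^sup>2"
          using bump_expansion(2)[OF x0, of y] z unfolding E_def q0_def z_def by simp
        ultimately show ?thesis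
          using True in_half by (simp add: g_def a3_def power2_eq_square)
      next
        case False
        then have "g * a3 y = 0" using in_half by (auto simp: g_def a3_def)
        then show ?thesis using E_low[of y] by linarith
      qed
      then show ?thesis using True by (simp add: E_def)
    next
      case False
      have "g * a3 y \<le> bump R (x0 + y)"
      proof (cases "norm (x0 + y) < R/2")
        case True
        then have z: "3/4 \<le> 1 - (norm (x0 + y))\<^sup>2 / R\<^sup>2" using bump_half_ball[OF R, of "x0 + y"] by simp
        then have "(3/4)\<^sup>2 \<le> bump R (x0 + y)" unfolding bump_def
          by (intro power_mono order_trans[OF z max.cobounded2]) auto
        moreover have "g * a3 y \<le> 1/4" by (auto simp: g_def a3_def indicator_def)
        ultimately show ?thesis by (simp add: power2_eq_square)
      next
        case False
        then have "a3 y = 0" using in_half by (auto simp: a3_def)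
        then show ?thesis using bump_range(1)[of R "x0 + y"] by simp
      qed
      then show ?thesis using False q0sq bump_x0 by simp
    qed
    have "M * (- (2 * q0 / R\<^sup>2) * (indicator (ball 0 R) y * (norm y)\<^sup>2) - q0 * indicator (- ball 0 R) y + g * a3 y) + H \<le> e y"
      unfolding e_eq using mult_left_mono[OF main M] by simp
    then have "(M * (- (2 * q0 / R\<^sup>2) * (indicator (ball 0 R) y * (norm y)\<^sup>2) - q0 * indicator (- ball 0 R) y + g * a3 y) + H) * K y \<le> e y * K y"
      using K0 by (intro mult_right_mono)
    moreover have "(M * (- (2 * q0 / R\<^sup>2) * (indicator (ball 0 R) y * (norm y)\<^sup>2) - q0 * indicator (- ball 0 R) y + g * a3 y) + H) * K y
        = - (2 * M * q0 / R\<^sup>2) * a1 y - M * q0 * a2 y + M * g * a3 y * K y + H * K y"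
      by (simp add: a1_def a2_def algebra_simps)
    moreover have "M * g * lam * (3 * R) powr (- P) * a3 y \<le> M * g * a3 y * K y"
    proof (cases "norm (x0 + y) < R/2")
      case True
      have "norm y \<le> norm (x0 + y) + norm x0" by (metis add_diff_cancel_left' norm_triangle_ineq4)
      then have "R + norm y \<le> 3 * R" using True x0 R by simp
      then have "(3 * R) powr (- P) \<le> k y"
        unfolding k_def using R Pneg norm_ge_zero[of y] by (intro powr_mono2') linarith+
      then have "lam * (3 * R) powr (- P) \<le> K y" using Kk par mult_left_mono[of "(3 * R) powr (- P)" "k y" lam] by linarith
      then have "M * g * a3 y * (lam * (3 * R) powr (- P)) \<le> M * g * a3 y * K y"
        using M g0 by (intro mult_left_mono) (auto simp: a3_def)
      then show ?thesis by (simp add: mult_ac)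
    next
      case False
      then show ?thesis using in_half by (auto simp: a3_def)
    qed
    moreover have "c * a5 y - c * M * R powr (- P) * a4 y \<le> H * K y"
    proof -
      have "M * bump R (x0 + y) * k y \<le> M * R powr (- P) * a4 y"
      proof (cases "norm (x0 + y) < R")
        case True
        have "k y \<le> R powr (- P)" unfolding k_def using R Pneg by (intro powr_mono2') auto
        then have "bump R (x0 + y) * k y \<le> 1 * R powr (- P)"
          using bump_range[of R "x0 + y"] k0 by (intro mult_mono) auto
        then show ?thesis using True in_R M by (simp add: a4_def mult.assoc mult_left_mono)
      next
        case False
        then show ?thesis using M R by (simp add: bump_outside a4_def)
      qed
      then have "a5 y - M * R powr (- P) * a4 y \<le> (indicator (- ball 0 \<epsilon>) y * U (x0 + y) - M * bump R (x0 + y)) * k y"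
        by (simp add: a5_def algebra_simps)
      also have "\<dots> \<le> H * k y" using H1 k0 by (intro mult_right_mono)
      finally have "c * (a5 y - M * R powr (- P) * a4 y) \<le> c * (H * k y)" using c(1) by (intro mult_left_mono)
      also have "\<dots> \<le> lam * (H * k y)" using c(2) H0 k0 by (intro mult_right_mono) auto
      also have "\<dots> = H * (lam * k y)" by simp
      also have "\<dots> \<le> H * K y" using Kk H0 by (intro mult_left_mono)
      finally show ?thesis by (simp add: algebra_simps)
    qed
    ultimately show ?thesis unfolding F_def by linarith
  qed
  have "(LINT y|lborel. F y) \<le> (LINT y|lborel. e y * K y)"
  proof (rule integral_mono_AE[OF F_int e_int])
    show "AE y in lborel. F y \<le> e y * K y"
      using AE_lborel_singleton[of "0::'a"] by eventually_elim (rule F_le)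
  qed
  moreover have "(LINT y|lborel. F y) = - (2 * M * q0 / R\<^sup>2) * (LINT y|lborel. a1 y) - M * q0 * (LINT y|lborel. a2 y)
      + M * g * lam * (3 * R) powr (- P) * ((R/2) ^ DIM('a) * \<beta>) - c * M * R powr (- P) * (R ^ DIM('a) * \<beta>)
      + c * (LINT y|lborel. a5 y)"
    unfolding F_def using a1 a2 a3 a4 a5 by simp
  moreover have "- (2 * M * q0 / R\<^sup>2) * (LINT y|lborel. a1 y) \<ge> - (2 * C1 * M * q0 * R powr (- 2 * s))"
  proof -
    have "(2 * M * q0 / R\<^sup>2) * (LINT y|lborel. a1 y) \<le> (2 * M * q0 / R\<^sup>2) * (C1 * (R\<^sup>2 * R powr (- 2 * s)))"
      using a1(2) M q0 by (intro mult_left_mono) auto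
    then show ?thesis using R by (simp add: mult_ac)
  qed
  moreover have "- (M * q0 * (LINT y|lborel. a2 y)) \<ge> - (C2 * M * q0 * R powr (- 2 * s))"
  proof -
    have "M * q0 * (LINT y|lborel. a2 y) \<le> M * q0 * (C2 * R powr (- 2 * s))"
      using a2(2) M q0 by (intro mult_left_mono) auto
    then show ?thesis by (simp add: mult_ac)
  qed
  moreover have dimR: "R ^ DIM('a) * R powr (- P) = R powr (- 2 * s)"
    using pos_powr_split(3)[OF R, of "DIM('a)" s] by (simp add: P_def)
  have "M * g * lam * (3 * R) powr (- P) * ((R/2) ^ DIM('a) * \<beta>) = M * R powr (- 2 * s) * (g * (lam * \<beta> * 3 powr (- P) / 2 ^ DIM('a)))"
    using R unfolding dimR[symmetric] by (simp add: powr_mult power_divide)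
  moreover have "c * M * R powr (- P) * (R ^ DIM('a) * \<beta>) = M * R powr (- 2 * s) * (c * \<beta>)"
    unfolding dimR[symmetric] by simp
  moreover have "M * R powr (- 2 * s) * (g * (lam * \<beta> * 3 powr (- P) / 2 ^ DIM('a)) - (2 * C1 + C2) * q0 - c * \<beta>)
      = M * R powr (- 2 * s) * (g * (lam * \<beta> * 3 powr (- P) / 2 ^ DIM('a))) - 2 * C1 * M * q0 * R powr (- 2 * s)
        - C2 * M * q0 * R powr (- 2 * s) - M * R powr (- 2 * s) * (c * \<beta>)"
    by (simp only: right_diff_distrib distrib_right) (simp add: mult_ac distrib_left)
  ultimately have "(LINT y|lborel. e y * K y) \<ge> c * (LINT y|lborel. a5 y)
      + M * R powr (- 2 * s) * (g * (lam * \<beta> * 3 powr (- P) / 2 ^ DIM('a)) - (2 * C1 + C2) * q0 - c * \<beta>)"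
    by linarith
  with L1 have "L_op s K v x0 \<ge> c * (LINT y|lborel. a5 y)
      + M * R powr (- 2 * s) * (g * (lam * \<beta> * 3 powr (- P) / 2 ^ DIM('a)) - (2 * C1 + C2 + 4 * C3) * q0 - c * \<beta>)"
    by (simp add: algebra_simps)
  moreover have "g * (lam * \<beta> * 3 powr (- P) / 2 ^ DIM('a)) = (if q0 \<le> 1/4 then lam * \<beta> * 3 powr (- P) / (4 * 2 ^ DIM('a)) else 0)"
    by (simp add: g_def)
  ultimately show "L_op s K v x0 \<ge> c * (LINT y|lborel. indicator (- ball 0 \<epsilon>) y * U (x0 + y) * (R + norm y) powr (- P))
      + M * R powr (- 2 * s) * ((if q0 \<le> 1/4 then lam * \<beta> * 3 powr (- P) / (4 * 2 ^ DIM('a)) else 0)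
          - (2 * C1 + C2 + 4 * C3) * q0 - c * \<beta>)"
    by (simp only: a5_def k_def)
qed

lemma lborel_translate:
  fixes f :: "'a::euclidean_space \<Rightarrow> real"
  assumes "integrable lborel f"
  shows "integrable lborel (\<lambda>y. f (z + y))" "(LINT y|lborel. f (z + y)) = (LINT x|lborel. f x)"
proof -
  have [measurable]: "f \<in> borel_measurable borel" using assms by auto
  have "integrable (distr lborel borel ((+) z)) f"
    using assms by (simp add: lborel_distr_plus)
  then show "integrable lborel (\<lambda>y. f (z + y))"
    by (simp add: integrable_distr_eq)
  have "(LINT x|distr lborel borel ((+) z). f x) = (LINT y|lborel. f (z + y))"
    by (rule integral_distr) auto
  then show "(LINT y|lborel. f (z + y)) = (LINT x|lborel. f x)"
    by (simp add: lborel_distr_plus)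
qed

text \<open>
  Moving the centre of the weight from \<open>x0\<close> to the origin costs the factor \<open>2\<^bsup>-P\<^esup>\<close>, since
  \<open>R + |x - x0| \<le> 2 (R + |x|)\<close>. The hole around the point of contact costs the mass of a small ball.
\<close>

lemma tail_integral_recentred:
  fixes U :: "'a::euclidean_space \<Rightarrow> real"
  assumes P: "0 \<le> P" and k: "integrable lborel (\<lambda>y::'a. (R + norm y) powr (- P))"
    and R: "0 < R" and x0: "x0 \<in> ball 0 R"
    and U: "U \<in> borel_measurable borel" "\<And>x. 0 \<le> U x" "\<And>x. U x \<le> B"
  shows "2 powr (- P) * ((LINT x|lborel. U x / (R + norm x) powr P) - B * R powr (- P) * measure lborel (ball x0 \<epsilon>))
     \<le> (LINT y|lborel. indicator (- ball 0 \<epsilon>) y * U (x0 + y) * (R + norm y) powr (- P))"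
proof -
  note U(1) [measurable]
  have [measurable]: "ball z r \<in> sets (borel :: 'a measure)" for z r by simp
  have B: "0 \<le> B" using U(2,3)[of 0] by linarith
  have bound: "integrable lborel f" if "f \<in> borel_measurable borel" "\<And>x. 0 \<le> f x" "\<And>x. f x \<le> B * (R + norm x) powr (- P)"
    for f :: "'a \<Rightarrow> real"
  proof (rule Bochner_Integration.integrable_bound)
    show "integrable lborel (\<lambda>x::'a. B * (R + norm x) powr (- P))" using k by simp
    show "AE x in lborel. norm (f x) \<le> norm (B * (R + norm x) powr (- P))"
      using that(2,3) by (intro AE_I2) (simp add: B)
  qed (use that in auto)
  have h_eq: "U x / (R + norm x) powr P = U x * (R + norm x) powr (- P)" for x
    by (simp add: powr_minus divide_inverse)
  have "integrable lborel (\<lambda>x. U x * (R + norm x) powr (- P))"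
    using U by (intro bound mult_right_mono) auto
  moreover have int_ball: "integrable lborel (indicator (ball x0 \<epsilon>) :: 'a \<Rightarrow> real)"
    using emeasure_lborel_ball_finite[of x0 \<epsilon>] by (simp add: integrable_indicator_iff)
  ultimately have int: "integrable lborel (\<lambda>x. U x * (R + norm x) powr (- P) - B * R powr (- P) * indicator (ball x0 \<epsilon>) x)"
    by simp
  have pw: "2 powr (- P) * (U (x0 + y) * (R + norm (x0 + y)) powr (- P) - B * R powr (- P) * indicator (ball x0 \<epsilon>) (x0 + y))
      \<le> indicator (- ball 0 \<epsilon>) y * U (x0 + y) * (R + norm y) powr (- P)" for y
  proof (cases "norm y < \<epsilon>")
    case True
    have "U (x0 + y) * (R + norm (x0 + y)) powr (- P) \<le> B * R powr (- P)"
      using U B R P by (intro mult_mono powr_mono2') auto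
    then have "2 powr (- P) * (U (x0 + y) * (R + norm (x0 + y)) powr (- P) - B * R powr (- P)) \<le> 0"
      by (intro mult_nonneg_nonpos) auto
    then show ?thesis using True by (simp add: dist_norm)
  next
    case False
    have "norm y \<le> norm (x0 + y) + norm x0" by (metis add_diff_cancel_left' norm_triangle_ineq4)
    then have "R + norm y \<le> 2 * (R + norm (x0 + y))" using x0 norm_ge_zero[of "x0 + y"]
      unfolding mem_ball_0 distrib_left by linarith
    then have "(2 * (R + norm (x0 + y))) powr (- P) \<le> (R + norm y) powr (- P)"
      using R P norm_ge_zero[of y] by (intro powr_mono2') linarith+
    then have "2 powr (- P) * (R + norm (x0 + y)) powr (- P) \<le> (R + norm y) powr (- P)"
      using powr_mult[of 2 "R + norm (x0 + y)" "- P"] R by simp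
    then have "U (x0 + y) * (2 powr (- P) * (R + norm (x0 + y)) powr (- P)) \<le> U (x0 + y) * (R + norm y) powr (- P)"
      using U by (intro mult_left_mono) auto
    then show ?thesis using False by (simp add: dist_norm mult_ac)
  qed
  have "2 powr (- P) * ((LINT x|lborel. U x / (R + norm x) powr P) - B * R powr (- P) * measure lborel (ball x0 \<epsilon>))
      = 2 powr (- P) * (LINT x|lborel. U x * (R + norm x) powr (- P) - B * R powr (- P) * indicator (ball x0 \<epsilon>) x)"
    unfolding h_eq using \<open>integrable lborel (\<lambda>x. U x * (R + norm x) powr (- P))\<close> int_ball by simp
  also have "\<dots> = (LINT y|lborel. 2 powr (- P) * (U (x0 + y) * (R + norm (x0 + y)) powr (- P) - B * R powr (- P) * indicator (ball x0 \<epsilon>) (x0 + y)))"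
    using lborel_translate(2)[OF int, of x0] by simp
  also have "\<dots> \<le> (LINT y|lborel. indicator (- ball 0 \<epsilon>) y * U (x0 + y) * (R + norm y) powr (- P))"
  proof (rule integral_mono[OF _ _ pw])
    show "integrable lborel (\<lambda>y. 2 powr (- P) * (U (x0 + y) * (R + norm (x0 + y)) powr (- P) - B * R powr (- P) * indicator (ball x0 \<epsilon>) (x0 + y)))"
      using lborel_translate(1)[OF int, of x0] by (intro integrable_mult_right)
    show "integrable lborel (\<lambda>y. indicator (- ball 0 \<epsilon>) y * U (x0 + y) * (R + norm y) powr (- P))"
    proof (rule bound)
      show "indicator (- ball 0 \<epsilon>) y * U (x0 + y) * (R + norm y) powr (- P) \<le> B * (R + norm y) powr (- P)" for y
        using U B by (intro mult_right_mono) (auto simp: indicator_def)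
    qed (use U in \<open>measurable, auto\<close>)
  qed
  finally show ?thesis .
qed

text \<open>
  In the comparison the barrier tolerates only a loss proportional to its own value, that is to \<open>q\<^sup>2\<close>, whereas gradient and
  second differences lose a multiple of \<open>q\<close>. For small \<open>q\<close> the gain \<open>A\<close> compensates for that; for the
  other \<open>q\<close>, the quotient \<open>q / q\<^sup>2\<close> is bounded.
\<close>

lemma quadratic_absorption:
  fixes A C :: real
  assumes "0 < A" "0 \<le> C"
  obtains C' where "0 < C'"
    "\<And>q t. 0 < q \<Longrightarrow> q \<le> 1 \<Longrightarrow> t \<le> A / 2 \<Longrightarrow> - (C' * q\<^sup>2) \<le> (if q \<le> 1/4 then A else 0) - C * q - t"
proof -
  \<comment> \<open>The threshold below which (C + 1) q is at most A / 2.\<close>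
  define \<theta> where "\<theta> = min (1/4) (A / (2 * (C + 1)))"
  have \<theta>: "0 < \<theta>" using assms by (auto simp: \<theta>_def)
  have \<theta>4: "\<theta> \<le> 1/4" unfolding \<theta>_def by (rule min.cobounded1)
  define C' where "C' = (C + A) / \<theta>\<^sup>2"
  have C': "0 < C'" using assms \<theta> by (simp add: C'_def)
  have "- (C' * q\<^sup>2) \<le> (if q \<le> 1/4 then A else 0) - C * q - t" if q: "0 < q" "q \<le> 1" and t: "t \<le> A / 2" for q t
  proof (cases "q \<le> \<theta>")
    case True
    have "(C + 1) * q \<le> (C + 1) * (A / (2 * (C + 1)))"
      using True assms by (intro mult_left_mono) (auto simp: \<theta>_def)
    also have "\<dots> = A / 2" using assms by (simp add: field_simps)
    finally have "C * q \<le> A / 2" using q by (simp add: distrib_right)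
    moreover have "0 \<le> C' * q\<^sup>2" using C' by simp
    ultimately show ?thesis using True \<theta>4 t by simp
  next
    case False
    have "\<theta>\<^sup>2 \<le> q\<^sup>2" using False \<theta> by (intro power_mono) auto
    then have "C' * \<theta>\<^sup>2 \<le> C' * q\<^sup>2" using C' by (intro mult_left_mono) auto
    moreover have "C' * \<theta>\<^sup>2 = C + A" using \<theta> by (simp add: C'_def)
    moreover have "C * q \<le> C" using q assms by (simp add: mult_left_le)
    ultimately show ?thesis using t assms by simp
  qed
  then show ?thesis using that C' by blast
qed

text \<open>
  The spatial half of the argument, uniformly in \<open>\<rho>\<close>, in \<open>R \<le> R0\<close> and in the kernel. The upper bound \<open>R0\<close>
  is used for the drift: \<open>|\<nabla> bump| \<le> 4 q0 / R\<close>, and \<open>1 / R \<le> R0\<^bsup>2s-1\<^esup> R\<^bsup>-2s\<^esup>\<close>.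
\<close>

lemma M_minus_touching_lower_bound:
  fixes s lam Lam R0 :: real
  assumes par: "1/2 \<le> s" "s < 1" "0 < lam" "0 < Lam" "0 < R0"
  shows "\<exists>C>0. \<exists>c>0. \<forall>\<rho> R M b \<epsilon> B x0. \<forall>U :: 'a::euclidean_space \<Rightarrow> real.
    0 \<le> \<rho> \<longrightarrow> \<rho> < R \<longrightarrow> R \<le> R0 \<longrightarrow> (kernels s lam Lam \<rho> :: ('a \<Rightarrow> real) set) \<noteq> {} \<longrightarrow>
    x0 \<in> ball 0 R \<longrightarrow> 0 \<le> M \<longrightarrow> 0 \<le> b \<longrightarrow> 0 < \<epsilon> \<longrightarrow>
    U \<in> borel_measurable borel \<longrightarrow> (\<forall>x. 0 \<le> U x \<and> U x \<le> B \<and> M * bump R x - b \<le> U x) \<longrightarrow>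
    (let v = (\<lambda>x. if x \<in> ball x0 \<epsilon> then M * bump R x - b else U x) in
      M_minus s lam Lam \<rho> v x0 - Lam * norm (gradient v x0)
      \<ge> c * ((LINT x|lborel. U x / (R + norm x) powr (real DIM('a) + 2 * s))
              - B * R powr (- (real DIM('a) + 2 * s)) * measure lborel (ball x0 \<epsilon>))
        - C * M * bump R x0 * R powr (- 2 * s))"
proof -
  have Lam0: "0 \<le> Lam" using par by simp
  obtain C1 where C1: "0 \<le> C1" "\<And>lam \<rho> R. \<And>K::'a \<Rightarrow> real. K \<in> kernels s lam Lam \<rho> \<Longrightarrow> 0 < R \<Longrightarrow>
     set_integrable lborel (ball 0 R) (\<lambda>y. (norm y)\<^sup>2 * K y) \<and>
     (LINT y:ball 0 R|lborel. (norm y)\<^sup>2 * K y) \<le> C1 * R powr (2 - 2 * s)"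
    using kernel_inner_moment[OF par(2) Lam0, where 'a='a] by blast
  have "real 0 < 2 * s" using par by simp
  then obtain C2 where C2: "0 \<le> C2" "\<And>lam \<rho> R. \<And>K::'a \<Rightarrow> real. K \<in> kernels s lam Lam \<rho> \<Longrightarrow> 0 < R \<Longrightarrow>
     set_integrable lborel (- ball 0 R) (\<lambda>y. norm y ^ 0 * K y) \<and>
     (LINT y:- ball 0 R|lborel. norm y ^ 0 * K y) \<le> C2 * R powr (real 0 - 2 * s)"
    using kernel_outer_moment[OF _ Lam0, where 'a='a] by blast
  obtain C3 where C3: "0 \<le> C3" "\<And>lam \<rho> R D. \<And>K::'a \<Rightarrow> real. K \<in> kernels s lam Lam \<rho> \<Longrightarrow> 0 < R \<Longrightarrow>
     integrable lborel (\<lambda>y. (y \<bullet> D) * (cutoff s y - indicator (ball 0 R) y) * K y) \<and>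
     \<bar>LINT y|lborel. (y \<bullet> D) * (cutoff s y - indicator (ball 0 R) y) * K y\<bar> \<le> C3 * norm D * R powr (1 - 2 * s)"
    using kernel_change_cutoff[OF par(1) Lam0, where 'a='a] by blast
  define \<beta> where "\<beta> = measure lborel (ball (0::'a) 1)"
  define P where "P = real DIM('a) + 2 * s"
  have P: "0 \<le> P" using par by (simp add: P_def)
  have \<beta>: "0 < \<beta>" unfolding \<beta>_def by (rule content_ball_pos) simp
  \<comment> \<open>A is the gain for small q0, C the loss from the kernel moments and C4 the one from the drift.\<close>
  define A where "A = lam * \<beta> * 3 powr (- P) / (4 * 2 ^ DIM('a))"
  have A: "0 < A" using par \<beta> by (simp add: A_def)
  define C where "C = 2 * C1 + C2 + 4 * C3"
  define C4 where "C4 = 4 * Lam * R0 powr (2 * s - 1)"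
  have C: "0 \<le> C" "0 \<le> C4" using C1 C2 C3 par by (simp_all add: C_def C4_def)
  \<comment> \<open>The excess of U over the barrier is counted with a weight so small that the loss c * \<beta> uses up at most
    half of the gain A.\<close>
  define c where "c = min lam (A / (2 * \<beta>))"
  have c: "0 < c" "c \<le> lam" "c * \<beta> \<le> A / 2"
  proof -
    show "0 < c" "c \<le> lam" using par A \<beta> by (auto simp: c_def)
    have "c * \<beta> \<le> A / (2 * \<beta>) * \<beta>" using \<beta> by (intro mult_right_mono) (auto simp: c_def)
    then show "c * \<beta> \<le> A / 2" using \<beta> by simp
  qed
  have "0 \<le> C + C4" using C by simp
  obtain C' where C': "0 < C'"
    "\<And>q t. 0 < q \<Longrightarrow> q \<le> 1 \<Longrightarrow> t \<le> A / 2 \<Longrightarrow> - (C' * q\<^sup>2) \<le> (if q \<le> 1/4 then A else 0) - (C + C4) * q - t"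
    using quadratic_absorption[OF A \<open>0 \<le> C + C4\<close>] by blast
  have "M_minus s lam Lam \<rho> v x0 - Lam * norm (gradient v x0)
      \<ge> c * 2 powr (- P) * ((LINT x|lborel. U x / (R + norm x) powr P) - B * R powr (- P) * measure lborel (ball x0 \<epsilon>))
        - C' * M * bump R x0 * R powr (- 2 * s)"
    if R: "0 \<le> \<rho>" "\<rho> < R" "R \<le> R0" and ne: "(kernels s lam Lam \<rho> :: ('a \<Rightarrow> real) set) \<noteq> {}"
      and x0: "x0 \<in> ball 0 R" and M: "0 \<le> M" and b: "0 \<le> b" and \<epsilon>: "0 < \<epsilon>"
      and Um: "U \<in> borel_measurable borel" and U: "\<And>x. 0 \<le> U x \<and> U x \<le> B \<and> M * bump R x - b \<le> U x"
      and v: "v = (\<lambda>x. if x \<in> ball x0 \<epsilon> then M * bump R x - b else U x)"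
    for \<rho> R M b \<epsilon> B x0 U and v :: "'a \<Rightarrow> real"
  proof -
    define q0 where "q0 = 1 - (norm x0)\<^sup>2 / R\<^sup>2"
    have q0: "0 < q0" "q0 \<le> 1" using inside_ball_pos[OF x0] by (simp_all add: q0_def)
    have bump_x0: "bump R x0 = q0\<^sup>2" using q0 by (simp add: bump_def q0_def)
    have Rpos: "0 < R" using R by simp
    define I where "I = (LINT y|lborel. indicator (- ball 0 \<epsilon>) y * U (x0 + y) * (R + norm y) powr (- P))"
    define X where "X = M * R powr (- 2 * s)"
    have X: "0 \<le> X" using M by (simp add: X_def)
    have main: "gradient v x0 = M *\<^sub>R bump_grad R x0"
      "c * I + X * ((if q0 \<le> 1/4 then A else 0) - C * q0 - c * \<beta>) \<le> L_op s K v x0"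
      if K: "K \<in> kernels s lam Lam \<rho>" for K
    proof -
      have 1: "set_integrable lborel (- ball 0 R) K" "(LINT y:- ball 0 R|lborel. K y) \<le> C2 * R powr (- 2 * s)"
        using C2(2)[OF K Rpos] by simp_all
      have 0: "0 \<le> U x" "U x \<le> B" "M * bump R x - b \<le> U x" for x using U by auto
      note est = L_op_touching_lower_bound[OF par(1-3) Lam0 R(1,2) K x0 M b \<epsilon> Um 0
          less_imp_le[OF c(1)] c(2) C1(2)[OF K Rpos, THEN conjunct1] C1(2)[OF K Rpos, THEN conjunct2] 1
          C3(2)[OF K Rpos, THEN conjunct1] C3(2)[OF K Rpos, THEN conjunct2] C3(1)]
      show "gradient v x0 = M *\<^sub>R bump_grad R x0"
        using est(1) by (simp only: v)
      show "c * I + X * ((if q0 \<le> 1/4 then A else 0) - C * q0 - c * \<beta>) \<le> L_op s K v x0"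
        using est(2) unfolding v I_def X_def A_def q0_def C_def \<beta>_def P_def .
    qed
    obtain K where K: "K \<in> (kernels s lam Lam \<rho> :: ('a \<Rightarrow> real) set)" using ne by blast
    have "c * I + X * ((if q0 \<le> 1/4 then A else 0) - C * q0 - c * \<beta>) \<le> M_minus s lam Lam \<rho> v x0"
      unfolding M_minus_def using ne main(2) by (intro cINF_greatest)
    moreover have "Lam * norm (gradient v x0) \<le> X * (C4 * q0)"
    proof -
      have "R powr (2 * s - 1) \<le> R0 powr (2 * s - 1)" using par R Rpos by (intro powr_mono2) auto
      then have "R powr (2 * s - 1) * R powr (- 2 * s) \<le> R0 powr (2 * s - 1) * R powr (- 2 * s)"
        by (intro mult_right_mono) auto
      moreover have "R powr (2 * s - 1) * R powr (- 2 * s) = 1 / R"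
        using Rpos powr_add[of R "2 * s - 1" "- 2 * s"] powr_neg_one[of R] by simp
      ultimately have Rinv: "1 / R \<le> R0 powr (2 * s - 1) * R powr (- 2 * s)" by simp
      have "Lam * norm (gradient v x0) = Lam * M * norm (bump_grad R x0)"
        using main(1)[OF K] M by simp
      also have "\<dots> \<le> Lam * M * (4 * q0 / R)"
        using norm_bump_grad_le[OF x0] M Lam0 unfolding q0_def by (intro mult_left_mono) auto
      also have "\<dots> = Lam * M * (4 * q0) * (1 / R)" by simp
      also have "\<dots> \<le> Lam * M * (4 * q0) * (R0 powr (2 * s - 1) * R powr (- 2 * s))"
        using Rinv M Lam0 q0 by (intro mult_left_mono) auto
      also have "\<dots> = X * (C4 * q0)" by (simp add: X_def C4_def)
      finally show ?thesis .
    qed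
    moreover have "- (C' * q0\<^sup>2) * X \<le> ((if q0 \<le> 1/4 then A else 0) - (C + C4) * q0 - c * \<beta>) * X"
      using C'(2)[OF q0 c(3)] X by (intro mult_right_mono)
    moreover have "((if q0 \<le> 1/4 then A else 0) - (C + C4) * q0 - c * \<beta>) * X
        = X * ((if q0 \<le> 1/4 then A else 0) - C * q0 - c * \<beta>) - X * (C4 * q0)"
      by (simp add: algebra_simps)
    moreover have "c * (2 powr (- P) * ((LINT x|lborel. U x / (R + norm x) powr P) - B * R powr (- P) * measure lborel (ball x0 \<epsilon>))) \<le> c * I"
    proof (intro mult_left_mono less_imp_le[OF c(1)])
      have "- P = - real DIM('a) - 2 * s" by (simp add: P_def)
      then have "integrable lborel (\<lambda>y::'a. (R + norm y) powr (- P))"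
        using weight_integrable[OF K, of R] par R by simp
      then show "2 powr (- P) * ((LINT x|lborel. U x / (R + norm x) powr P) - B * R powr (- P) * measure lborel (ball x0 \<epsilon>)) \<le> I"
        unfolding I_def using P Rpos x0 Um U by (intro tail_integral_recentred) auto
    qed
    moreover have "C' * M * bump R x0 * R powr (- 2 * s) = C' * q0\<^sup>2 * X"
      by (simp add: bump_x0 X_def)
    moreover have "- (C' * q0\<^sup>2) * X = - (C' * q0\<^sup>2 * X)" by simp
    ultimately show ?thesis unfolding mult.assoc[of c "2 powr (- P)"] by linarith
  qed
  note res = this
  have pos: "0 < c * 2 powr (- P)" using c by simp
  show ?thesis
    unfolding Let_def P_def[symmetric]
    by (intro exI[of _ C'] conjI C'(1) exI[of _ "c * 2 powr (- P)"] pos allI impI res refl) auto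
qed

section \<open>Comparison with the barrier\<close>

lemma Linfty_section_measurable:
  assumes "u \<in> Linfty ((UNIV :: 'a::euclidean_space set) \<times> I)" "t \<in> I"
  shows "(\<lambda>x. u (x, t :: real)) \<in> borel_measurable borel"
proof -
  have "(\<lambda>x::'a. (x, t)) \<in> borel \<rightarrow>\<^sub>M restrict_space borel (UNIV \<times> I)"
    using assms(2) by (intro measurable_restrict_space2) (auto intro!: borel_measurable_continuous_onI continuous_intros)
  moreover have "u \<in> borel_measurable (restrict_space borel (UNIV \<times> I))"
    using assms(1) by (simp add: Linfty_def)
  ultimately show ?thesis by (rule measurable_compose)
qed

lemma left_deriv_eqI:
  assumes "(g has_real_derivative D) (at t)" "0 < \<epsilon>" "\<And>\<tau>. t - \<epsilon> < \<tau> \<Longrightarrow> \<tau> \<le> t \<Longrightarrow> h \<tau> = g \<tau>"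
  shows "left_deriv h t = D"
proof -
  have "(g has_vector_derivative D) (at_left t)"
    using assms(1) by (metis has_real_derivative_iff_has_vector_derivative has_vector_derivative_at_within)
  moreover have "\<forall>\<^sub>F \<tau> in nhds t. \<tau> \<in> {..<t} \<longrightarrow> g \<tau> = h \<tau>"
    using assms(2,3) by (auto simp: eventually_nhds intro!: exI[of _ "{t - \<epsilon><..}"])
  ultimately have "(h has_vector_derivative D) (at_left t)"
    using has_vector_derivative_cong_ev[of "{..<t}" g h t D] assms(2,3) by simp
  then show ?thesis
    unfolding left_deriv_def by (intro vector_derivative_within) auto
qed

lemma C11_on_bump:
  assumes "x0 \<in> ball 0 R" "ball x0 \<epsilon> \<subseteq> ball (0::'a::euclidean_space) R"
  shows "C11_on (ball x0 \<epsilon>) (\<lambda>x. p * bump R x - k)"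
proof -
  have R: "0 < R" using assms(1) norm_ge_zero[of x0] unfolding mem_ball_0 by linarith
  have "GDERIV (\<lambda>x. p * bump R x - k) x :> p *\<^sub>R bump_grad R x" if "x \<in> ball x0 \<epsilon>" for x
    using GDERIV_bump[of x R] that assms(2) unfolding gderiv_def
    by (auto intro!: derivative_eq_intros simp: inner_commute)
  moreover have "(\<bar>p\<bar> * (12 / R\<^sup>2))-lipschitz_on (ball x0 \<epsilon>) (\<lambda>x. p *\<^sub>R bump_grad R x)"
    using lipschitz_on_subset[OF lipschitz_bump_grad[OF R] assms(2)] by (rule lipschitz_on_cmult)
  ultimately show ?thesis
    unfolding C11_on_def by (intro exI[of _ "\<lambda>x. p *\<^sub>R bump_grad R x"] exI[of _ "\<bar>p\<bar> * (12 / R\<^sup>2)"]) auto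
qed

text \<open>
  Brings the modified function at the time of contact into the form to which the estimates of \<open>M_minus\<close>
  apply; its left derivative there is that of the test function.
\<close>

lemma visc_superD:
  fixes x0 :: "'a::euclidean_space"
  assumes "visc_super s lam Lam \<rho> \<Omega> I f u" "x0 \<in> \<Omega>" "t0 \<in> I" "0 < \<epsilon>"
    and "ball x0 \<epsilon> \<times> {t0 - \<epsilon><..t0} \<subseteq> \<Omega> \<times> I"
    and "\<And>x t. x \<in> ball x0 \<epsilon> \<Longrightarrow> t \<in> {t0 - \<epsilon><..t0} \<Longrightarrow> (\<lambda>\<tau>. \<phi> (x, \<tau>)) differentiable (at_left t)"
    and "\<And>t. t \<in> {t0 - \<epsilon><..t0} \<Longrightarrow> C11_on (ball x0 \<epsilon>) (\<lambda>x. \<phi> (x, t))"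
    and "u (x0, t0) = \<phi> (x0, t0)"
    and "\<And>x t. x \<in> ball x0 \<epsilon> \<Longrightarrow> t \<in> {t0 - \<epsilon><..t0} \<Longrightarrow> \<phi> (x, t) \<le> u (x, t)"
    and D: "((\<lambda>\<tau>. \<phi> (x0, \<tau>)) has_real_derivative D) (at t0)"
  shows "f (x0, t0) \<le> D + Lam * norm (gradient (\<lambda>x. if x \<in> ball x0 \<epsilon> then \<phi> (x, t0) else u (x, t0)) x0)
      - M_minus s lam Lam \<rho> (\<lambda>x. if x \<in> ball x0 \<epsilon> then \<phi> (x, t0) else u (x, t0)) x0"
proof -
  define N where "N = ball x0 \<epsilon> \<times> {t0 - \<epsilon><..t0}"
  define v where "v = (\<lambda>z. if z \<in> N then \<phi> z else u z)"
  have "f (x0, t0) \<le> left_deriv (\<lambda>\<tau>. v (x0, \<tau>)) t0 + Lam * norm (gradient (\<lambda>x. v (x, t0)) x0)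
      - M_minus s lam Lam \<rho> (\<lambda>x. v (x, t0)) x0"
    using assms(1)[unfolded visc_super_def Let_def, THEN conjunct2, THEN conjunct2, rule_format, of x0 t0 \<epsilon> \<phi>]
      assms(2-9) unfolding v_def N_def by auto
  moreover have "left_deriv (\<lambda>\<tau>. v (x0, \<tau>)) t0 = D"
    by (rule left_deriv_eqI[OF D \<open>0 < \<epsilon>\<close>]) (use \<open>0 < \<epsilon>\<close> in \<open>auto simp: v_def N_def\<close>)
  moreover have "(\<lambda>x. v (x, t0)) = (\<lambda>x. if x \<in> ball x0 \<epsilon> then \<phi> (x, t0) else u (x, t0))"
    using \<open>0 < \<epsilon>\<close> by (auto simp: v_def N_def)
  ultimately show ?thesis by simp
qed

text \<open>
  If the barrier exceeded \<open>u\<close> somewhere, then after a small tilt (slope \<open>a + e\<close> instead of \<open>a\<close>) and a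
  small shift down, \<open>u\<close> minus the barrier would have a negative minimum \<open>-\<kappa>\<close>, and the barrier lowered
  by \<open>\<kappa>\<close> would touch \<open>u\<close> from below there. The function \<open>m\<close> is not differentiable in time, but the Dini
  bound says that to the left of the time of contact it lies above the line of slope \<open>f t0 + d\<close> through
  its value; replacing \<open>m\<close> by this line gives an admissible test function. In the resulting inequality
  the decay of the exponential cancels the loss \<open>C M bump / T\<close>, the tail integral pays for the growth
  \<open>f t0\<close>, and the tilt leaves the contradiction \<open>0 \<le> -e/(2T)\<close>.
\<close>

lemma barrier_below_supersolution:
  fixes u :: "'a::euclidean_space \<times> real \<Rightarrow> real" and s lam Lam \<rho> R a c C :: real
  defines "T \<equiv> R powr (2 * s)" and "P \<equiv> real DIM('a) + 2 * s"
  assumes R: "0 < R" and a: "0 \<le> a" and c: "0 < c" and C: "0 < C"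
    and est: "\<And>M b \<epsilon> B x0. \<And>U :: 'a \<Rightarrow> real. x0 \<in> ball 0 R \<Longrightarrow> 0 \<le> M \<Longrightarrow> 0 \<le> b \<Longrightarrow> 0 < \<epsilon> \<Longrightarrow>
      U \<in> borel_measurable borel \<Longrightarrow> \<forall>x. 0 \<le> U x \<and> U x \<le> B \<and> M * bump R x - b \<le> U x \<Longrightarrow>
      M_minus s lam Lam \<rho> (\<lambda>x. if x \<in> ball x0 \<epsilon> then M * bump R x - b else U x) x0
        - Lam * norm (gradient (\<lambda>x. if x \<in> ball x0 \<epsilon> then M * bump R x - b else U x) x0)
      \<ge> c * ((LINT x|lborel. U x / (R + norm x) powr P) - B * R powr (- P) * measure lborel (ball x0 \<epsilon>))
        - C * M * bump R x0 * R powr (- 2 * s)"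
    and u: "u \<in> Linfty (UNIV \<times> time_int s R)" "\<And>x t. t \<in> {- T..0} \<Longrightarrow> 0 \<le> u (x, t)"
    and visc: "visc_super s lam Lam \<rho> (ball 0 R) (time_int s R) (\<lambda>_. - (R powr (- 2 * s)) * a) u"
    and m: "continuous_on UNIV m" "\<And>t. 0 \<le> m t" "\<And>t. t \<le> - T \<Longrightarrow> m t = 0"
    and f: "\<And>t. 0 \<le> f t" "\<And>t. t \<in> time_int s R \<Longrightarrow> f t \<le> (LINT x|lborel. u (x, t) / (R + norm x) powr P)"
    and dini: "\<And>t d. 0 < d \<Longrightarrow> \<forall>\<^sub>F \<tau> in at_left t. m t - m \<tau> \<le> (f t + d) * (t - \<tau>)"
    and z: "x1 \<in> ball 0 R" "t1 \<in> time_int s R"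
  shows "c * exp (- C * (t1 + T) / T) * m t1 * bump R x1 - a * (t1 + T) / T \<le> u (x1, t1)"
proof (rule ccontr)
  assume "\<not> ?thesis"
  then have viol: "u (x1, t1) < c * exp (- C * (t1 + T) / T) * m t1 * bump R x1 - a * (t1 + T) / T" by simp
  have T: "0 < T" "R powr (- 2 * s) = 1 / T" using R by (auto simp: T_def powr_minus_divide)
  have I: "time_int s R = {- T<..0}" by (simp add: time_int_def T_def)
  have P: "time_int s R \<subseteq> {- T..0}" by (auto simp: I)
  \<comment> \<open>One third of the violation, because the tilt and the shift each use up at most one e.\<close>
  define e where "e = (c * exp (- C * (t1 + T) / T) * m t1 * bump R x1 - a * (t1 + T) / T - u (x1, t1)) / 3"
  have e: "0 < e" using viol by (simp add: e_def)
  define a' where "a' = a + e"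
  have a': "0 < a'" using a e by (simp add: a'_def)
  define mu where "mu t = c * exp (- C * (t + T) / T) * m t" for t
  have mu: "continuous_on UNIV mu" "0 \<le> mu t" "t \<le> - T \<Longrightarrow> mu t = 0" for t
    unfolding mu_def using m c T by (auto intro!: continuous_intros)
  define \<psi> where "\<psi> z = mu (snd z) * bump R (fst z) - (a' * (snd z + T) / T + e)" for z :: "'a \<times> real"
  have cont_mb: "continuous_on S (\<lambda>z. mu (snd z) * bump R (fst z))" for S :: "('a \<times> real) set"
    by (intro continuous_intros continuous_on_compose2[OF mu(1)]) auto
  have cont_\<psi>: "continuous_on S \<psi>" for S
    unfolding \<psi>_def using T by (intro continuous_intros cont_mb) auto
  have time_frac: "0 \<le> (t + T) / T" "(t + T) / T \<le> 1" if "t \<in> time_int s R" for t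
    using that T by (auto simp: I)
  \<comment> \<open>Outside this compact subset of the cylinder the tilted barrier is negative.\<close>
  define S :: "('a \<times> real) set" where "S = (cball 0 R \<times> {- T..0}) \<inter> {z. e \<le> mu (snd z) * bump R (fst z)}"
  have "compact S"
    unfolding S_def by (intro compact_Int_closed compact_Times closed_Collect_le cont_mb continuous_on_const) auto
  have S_sub: "S \<subseteq> ball 0 R \<times> time_int s R"
  proof
    fix z assume z: "z \<in> S"
    obtain x t where xt: "z = (x, t)" by (cases z)
    have pos: "0 < mu t * bump R x" using z e by (simp add: S_def xt)
    have "norm x < R" using pos bump_outside[OF R, of x] by (cases "norm x < R") auto
    moreover have "- T < t" using pos mu(3)[of t] by (cases "- T < t") auto
    ultimately show "z \<in> ball 0 R \<times> time_int s R" using z by (simp add: S_def xt I)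
  qed
  have below_S: "\<psi> (x, t) < 0" if "t \<in> time_int s R" "mu t * bump R x < e" for x t
  proof -
    have "0 \<le> a' * (t + T) / T" using time_frac(1)[OF that(1)] a' by (metis mult_nonneg_nonneg less_imp_le times_divide_eq_right)
    then show ?thesis using that(2) by (simp add: \<psi>_def)
  qed
  have viol': "u (x1, t1) < \<psi> (x1, t1)"
  proof -
    have "a' * (t1 + T) / T = (a * (t1 + T) + e * (t1 + T)) / T"
      by (simp only: a'_def distrib_right)
    also have "\<dots> = a * (t1 + T) / T + e * ((t1 + T) / T)"
      by (simp only: add_divide_distrib[of "a * (t1 + T)"] times_divide_eq_right)
    also have "\<dots> \<le> a * (t1 + T) / T + e"
      using time_frac[OF z(2)] e by (intro add_left_mono mult_left_le) auto
    finally have "a' * (t1 + T) / T \<le> a * (t1 + T) / T + e" .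
    moreover have "3 * e = mu t1 * bump R x1 - a * (t1 + T) / T - u (x1, t1)" by (simp add: e_def mu_def)
    moreover have "\<psi> (x1, t1) = mu t1 * bump R x1 - (a' * (t1 + T) / T + e)" by (simp add: \<psi>_def)
    ultimately show ?thesis using e by linarith
  qed
  have u0: "0 \<le> u (x, t)" if "t \<in> time_int s R" for x t using u(2) that P by auto
  have "(x1, t1) \<in> S"
  proof -
    have "\<not> mu t1 * bump R x1 < e" using below_S[OF z(2)] viol' u0[OF z(2), of x1] by force
    then show ?thesis using z P by (auto simp: S_def)
  qed
  have lsc: "lsc_on S (\<lambda>z. u z - \<psi> z)"
  proof (rule lsc_on_diff_continuous[OF lsc_on_subset[OF _ S_sub] cont_\<psi>])
    show "lsc_on (ball 0 R \<times> time_int s R) u" using visc unfolding visc_super_def by (elim conjE)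
  qed
  have "S \<noteq> {}" using \<open>(x1, t1) \<in> S\<close> by auto
  obtain z0 where z0: "z0 \<in> S" "\<And>w. w \<in> S \<Longrightarrow> u z0 - \<psi> z0 \<le> u w - \<psi> w"
    by (rule lsc_on_attains_min[OF \<open>compact S\<close> \<open>S \<noteq> {}\<close> lsc], rule that)
  obtain x0 t0 where z0_eq: "z0 = (x0, t0)" by (cases z0)
  define \<kappa> where "\<kappa> = \<psi> (x0, t0) - u (x0, t0)"
  have \<kappa>: "0 < \<kappa>" using z0(2)[OF \<open>(x1, t1) \<in> S\<close>] viol' by (simp add: \<kappa>_def z0_eq)
  have x0: "x0 \<in> ball 0 R" and t0: "t0 \<in> time_int s R" using z0(1) S_sub by (auto simp: z0_eq)
  have touch: "\<psi> (x, t) - \<kappa> \<le> u (x, t)" if t: "t \<in> time_int s R" for x t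
  proof (cases "(x, t) \<in> S")
    case True
    then show ?thesis using z0(2)[of "(x, t)"] by (simp add: \<kappa>_def z0_eq)
  next
    case False
    have "mu t * bump R x < e"
    proof (cases "norm x \<le> R")
      case True
      then show ?thesis using False t P by (auto simp: S_def)
    next
      case False
      then show ?thesis using bump_outside[OF R, of x] e by simp
    qed
    then show ?thesis using below_S[OF t] u0[OF t, of x] \<kappa> by force
  qed
  obtain B where B: "0 < B" "\<And>x t. t \<in> time_int s R \<Longrightarrow> u (x, t) \<le> B"
  proof -
    obtain B where "\<forall>y\<in>u ` (UNIV \<times> time_int s R). norm y \<le> B" "0 < B"
      using u(1) unfolding Linfty_def bounded_pos by blast
    moreover from this have "u (x, t) \<le> B" if "t \<in> time_int s R" for x t
      using that abs_le_D1[of "u (x, t)" B] by auto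
    ultimately show thesis using that by blast
  qed
  define M where "M = mu t0"
  define b where "b = a' * (t0 + T) / T + e + \<kappa>"
  have M: "0 \<le> M" using mu by (simp add: M_def)
  have b: "0 \<le> b"
    using time_frac(1)[OF t0] a' e \<kappa> unfolding b_def times_divide_eq_right[symmetric] by (intro add_nonneg_nonneg mult_nonneg_nonneg) auto
  define G where "G = (LINT x|lborel. u (x, t0) / (R + norm x) powr P)"
  \<comment> \<open>Small enough for the two errors c * d, one from the slope and one from the hole in the tail integral, to
    add up to less than the gain e / T from the tilt.\<close>
  define d where "d = e / (4 * c * T)"
  have d: "0 < d" using e c T by (simp add: d_def)
  define \<beta> where "\<beta> = measure lborel (ball (0::'a) 1)"
  \<comment> \<open>A neighbourhood so small that m lies above the line of slope f t0 + d through its value at t0, and that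
    the tail integral over its complement loses little.\<close>
  obtain h where h: "h < t0" "\<And>\<tau>. h < \<tau> \<Longrightarrow> \<tau> < t0 \<Longrightarrow> m t0 - m \<tau> \<le> (f t0 + d) * (t0 - \<tau>)"
    using dini[OF d, of t0] unfolding eventually_at_left_field by blast
  define \<epsilon> where "\<epsilon> = Min {t0 - h, t0 + T, R - norm x0, 1, d / (B * R powr (- P) * \<beta> + 1)}"
  have BR: "0 \<le> B * R powr (- P) * \<beta>" using B by (simp add: \<beta>_def)
  have \<epsilon>: "0 < \<epsilon>" "\<epsilon> \<le> t0 - h" "\<epsilon> \<le> t0 + T" "\<epsilon> \<le> R - norm x0" "\<epsilon> \<le> 1" "\<epsilon> \<le> d / (B * R powr (- P) * \<beta> + 1)"
  proof -
    let ?E = "{t0 - h, t0 + T, R - norm x0, 1, d / (B * R powr (- P) * \<beta> + 1)}"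
    have "0 < y" if "y \<in> ?E" for y
      using that h(1) t0 x0 d BR by (auto simp: I)
    then show "0 < \<epsilon>" unfolding \<epsilon>_def by (subst Min_gr_iff) blast+
    have "\<epsilon> \<le> y" if "y \<in> ?E" for y
      unfolding \<epsilon>_def by (rule Min_le[OF _ that]) simp
    then show "\<epsilon> \<le> t0 - h" "\<epsilon> \<le> t0 + T" "\<epsilon> \<le> R - norm x0" "\<epsilon> \<le> 1" "\<epsilon> \<le> d / (B * R powr (- P) * \<beta> + 1)"
      by blast+
  qed
  have loss: "B * R powr (- P) * measure lborel (ball x0 \<epsilon>) \<le> d"
  proof -
    have "\<epsilon> ^ DIM('a) \<le> \<epsilon> ^ 1" using \<epsilon> DIM_positive[where 'a='a] by (intro power_decreasing) (auto simp: Suc_le_eq)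
    then have "measure lborel (ball x0 \<epsilon>) \<le> \<epsilon> * \<beta>"
      using content_ball_conv_unit_ball[of \<epsilon> x0] \<epsilon> by (simp add: \<beta>_def mult_right_mono)
    then have "B * R powr (- P) * measure lborel (ball x0 \<epsilon>) \<le> B * R powr (- P) * (\<epsilon> * \<beta>)"
      using B by (intro mult_left_mono) auto
    also have "\<dots> = B * R powr (- P) * \<beta> * \<epsilon>" by simp
    also have "\<dots> \<le> (B * R powr (- P) * \<beta> + 1) * \<epsilon>" using \<epsilon> by (intro mult_right_mono) auto
    also have "\<dots> \<le> (B * R powr (- P) * \<beta> + 1) * (d / (B * R powr (- P) * \<beta> + 1))"
      using BR by (intro mult_left_mono \<epsilon>(6)) auto
    also have "\<dots> = d" using BR by simp
    finally show ?thesis .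
  qed
  have sub: "ball x0 \<epsilon> \<subseteq> ball 0 R"
  proof
    fix x assume "x \<in> ball x0 \<epsilon>"
    then have "norm (x - x0) < \<epsilon>" by (simp add: dist_norm norm_minus_commute)
    then show "x \<in> ball 0 R" using norm_triangle_sub[of x x0] \<epsilon>(4) by simp
  qed
  have N_time: "{t0 - \<epsilon><..t0} \<subseteq> time_int s R" using \<epsilon>(3) t0 by (auto simp: I)
  define p where "p \<tau> = c * exp (- C * (\<tau> + T) / T) * (m t0 + (f t0 + d) * (\<tau> - t0))" for \<tau>
  define k where "k \<tau> = a' * (\<tau> + T) / T + e + \<kappa>" for \<tau>
  define \<phi> where "\<phi> z = p (snd z) * bump R (fst z) - k (snd z)" for z :: "'a \<times> real"
  define D where "D = c * (exp (- C * (t0 + T) / T) * (f t0 + d)) * bump R x0 - C / T * M * bump R x0 - a' / T"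
  have exp_deriv: "((\<lambda>\<tau>. exp (- C * (\<tau> + T) / T)) has_real_derivative exp (- C * (t + T) / T) * (- C / T)) (at t)" for t
    using T by (auto intro!: derivative_eq_intros)
  have lin_deriv: "((\<lambda>\<tau>. m t0 + (f t0 + d) * (\<tau> - t0)) has_real_derivative f t0 + d) (at t)" for t
    by (auto intro!: derivative_eq_intros)
  have p_deriv: "(p has_real_derivative c * (exp (- C * (t + T) / T) * (- C / T)) * (m t0 + (f t0 + d) * (t - t0))
      + (f t0 + d) * (c * exp (- C * (t + T) / T))) (at t)" for t
    unfolding p_def by (intro DERIV_mult DERIV_cmult exp_deriv lin_deriv)
  have k_deriv: "(k has_real_derivative a' / T) (at t)" for t
    unfolding k_def using T by (auto intro!: derivative_eq_intros)
  have \<phi>_deriv: "((\<lambda>\<tau>. \<phi> (x, \<tau>)) has_real_derivative (c * (exp (- C * (t + T) / T) * (- C / T)) * (m t0 + (f t0 + d) * (t - t0))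
      + (f t0 + d) * (c * exp (- C * (t + T) / T))) * bump R x - a' / T) (at t)" for x t
    unfolding \<phi>_def fst_conv snd_conv by (intro DERIV_diff DERIV_cmult_right p_deriv k_deriv)
  have pM: "p t0 = M" and kb: "k t0 = b" by (simp_all add: p_def M_def mu_def k_def b_def)
  have "- (R powr (- 2 * s)) * a \<le> D
      + Lam * norm (gradient (\<lambda>x. if x \<in> ball x0 \<epsilon> then \<phi> (x, t0) else u (x, t0)) x0)
      - M_minus s lam Lam \<rho> (\<lambda>x. if x \<in> ball x0 \<epsilon> then \<phi> (x, t0) else u (x, t0)) x0"
  proof (rule visc_superD[OF visc x0 t0 \<epsilon>(1)])
    show "ball x0 \<epsilon> \<times> {t0 - \<epsilon><..t0} \<subseteq> ball 0 R \<times> time_int s R" using sub N_time by blast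
    show "(\<lambda>\<tau>. \<phi> (x, \<tau>)) differentiable (at_left t)" for x t
      using \<phi>_deriv[of x t] by (meson differentiable_at_withinI real_differentiable_def)
    show "C11_on (ball x0 \<epsilon>) (\<lambda>x. \<phi> (x, t))" for t
      unfolding \<phi>_def fst_conv snd_conv by (rule C11_on_bump[OF x0 sub])
    show "u (x0, t0) = \<phi> (x0, t0)"
      by (simp add: \<phi>_def pM k_def \<kappa>_def \<psi>_def M_def)
    show "\<phi> (x, t) \<le> u (x, t)" if "x \<in> ball x0 \<epsilon>" "t \<in> {t0 - \<epsilon><..t0}" for x t
    proof -
      have "p t \<le> mu t"
      proof (cases "t = t0")
        case True
        then show ?thesis using pM by (simp add: M_def)
      next
        case False
        then have "m t0 - m t \<le> (f t0 + d) * (t0 - t)" using h(2)[of t] that \<epsilon>(2) by auto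
        then have "m t0 + (f t0 + d) * (t - t0) \<le> m t" by (simp add: algebra_simps)
        then show ?thesis unfolding p_def mu_def using c by (intro mult_left_mono) auto
      qed
      then have "p t * bump R x \<le> mu t * bump R x" using bump_range by (intro mult_right_mono)
      then have "\<phi> (x, t) \<le> \<psi> (x, t) - \<kappa>" by (simp add: \<phi>_def \<psi>_def k_def)
      also have "\<dots> \<le> u (x, t)" using touch N_time that by blast
      finally show ?thesis .
    qed
    show "((\<lambda>\<tau>. \<phi> (x0, \<tau>)) has_real_derivative D) (at t0)"
    proof (rule DERIV_cong[OF \<phi>_deriv])
      show "(c * (exp (- C * (t0 + T) / T) * (- C / T)) * (m t0 + (f t0 + d) * (t0 - t0))
          + (f t0 + d) * (c * exp (- C * (t0 + T) / T))) * bump R x0 - a' / T = D"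
        by (simp add: D_def M_def mu_def algebra_simps)
    qed
  qed
  moreover have "(\<lambda>x. if x \<in> ball x0 \<epsilon> then \<phi> (x, t0) else u (x, t0))
      = (\<lambda>x. if x \<in> ball x0 \<epsilon> then M * bump R x - b else u (x, t0))"
    by (simp add: \<phi>_def pM kb cong: if_cong)
  moreover have "M_minus s lam Lam \<rho> (\<lambda>x. if x \<in> ball x0 \<epsilon> then M * bump R x - b else u (x, t0)) x0
        - Lam * norm (gradient (\<lambda>x. if x \<in> ball x0 \<epsilon> then M * bump R x - b else u (x, t0)) x0)
      \<ge> c * (G - B * R powr (- P) * measure lborel (ball x0 \<epsilon>)) - C * M * bump R x0 * R powr (- 2 * s)"
    unfolding G_def
  proof (rule est[OF x0 M b \<epsilon>(1)])
    show "(\<lambda>x. u (x, t0)) \<in> borel_measurable borel" by (rule Linfty_section_measurable[OF u(1) t0])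
    show "\<forall>x. 0 \<le> u (x, t0) \<and> u (x, t0) \<le> B \<and> M * bump R x - b \<le> u (x, t0)"
      using u0[OF t0] B(2)[OF t0] touch[OF t0] by (simp add: \<psi>_def M_def b_def algebra_simps)
  qed
  ultimately have ineq: "c * (G - B * R powr (- P) * measure lborel (ball x0 \<epsilon>)) - C * M * bump R x0 * (1 / T) - (1 / T) * a \<le> D"
    unfolding T(2) by simp
  define Y where "Y = c * (exp (- C * (t0 + T) / T) * (f t0 + d)) * bump R x0"
  define r where "r = e / T"
  define Z where "Z = C * M * bump R x0 * (1 / T) + (1 / T) * a"
  have "Y \<le> c * (1 * (G + d)) * 1"
    unfolding Y_def
  proof (intro mult_mono)
    show "exp (- C * (t0 + T) / T) \<le> 1" using t0 C T by (simp add: I divide_nonpos_pos)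
    show "f t0 + d \<le> G + d" using f(2)[OF t0] by (simp add: G_def)
    show "0 \<le> c * (1 * (G + d))" using c d f(1)[of t0] f(2)[OF t0] by (simp add: G_def)
  qed (use c d f(1)[of t0] bump_range in auto)
  also have "\<dots> = c * (G - d) + 2 * (c * d)" by (simp add: algebra_simps)
  also have "2 * (c * d) = r / 2" using c T by (simp add: d_def r_def field_simps)
  finally have "Y \<le> c * (G - d) + r / 2" .
  moreover have "c * (G - B * R powr (- P) * measure lborel (ball x0 \<epsilon>)) \<ge> c * (G - d)"
    using loss c by (intro mult_left_mono) auto
  then have "c * (G - d) - Z \<le> D" using ineq unfolding Z_def by linarith
  moreover have "D = Y - Z - r"
    by (simp add: D_def a'_def Y_def Z_def r_def add_divide_distrib)
  moreover have "0 < r" using e T by (simp add: r_def)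
  ultimately show False by linarith
qed

theorem theorem2p1:
  fixes s lam Lam R0 :: real
  assumes "1/2 \<le> s" and "s < 1" and "0 < lam" and "0 < Lam" and "0 < R0"
  shows "\<exists>c>0. \<forall>\<rho> a R. \<forall>u :: 'a::euclidean_space \<times> real \<Rightarrow> real.
    0 \<le> \<rho> \<longrightarrow> 0 \<le> a \<longrightarrow> \<rho> < R \<longrightarrow> R \<le> R0 \<longrightarrow>
    (kernels s lam Lam \<rho> :: ('a \<Rightarrow> real) set) \<noteq> {} \<longrightarrow>
    u \<in> Linfty (UNIV \<times> time_int s R) \<longrightarrow>
    (\<forall>x. \<forall>t\<in>{- (R powr (2 * s))..0}. 0 \<le> u (x, t)) \<longrightarrow>
    visc_super s lam Lam \<rho> (ball 0 R) (time_int s R) (\<lambda>_. - (R powr (- 2 * s)) * a) u \<longrightarrow>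
    (INF z\<in>cyl s (R / 2). u z) \<ge>
      c * (LINT t:(time_int s R - time_int s (R / 2))|lborel.
            LINT x|lborel. u (x, t) / (R + norm x) powr (real DIM('a) + 2 * s)) - a"
proof -
  define P where "P = real DIM('a) + 2 * s"
  obtain C c where C: "0 < C" and c: "0 < c" and est: "\<forall>\<rho> R M b \<epsilon> B x0. \<forall>U :: 'a \<Rightarrow> real.
    0 \<le> \<rho> \<longrightarrow> \<rho> < R \<longrightarrow> R \<le> R0 \<longrightarrow> (kernels s lam Lam \<rho> :: ('a \<Rightarrow> real) set) \<noteq> {} \<longrightarrow>
    x0 \<in> ball 0 R \<longrightarrow> 0 \<le> M \<longrightarrow> 0 \<le> b \<longrightarrow> 0 < \<epsilon> \<longrightarrow>
    U \<in> borel_measurable borel \<longrightarrow> (\<forall>x. 0 \<le> U x \<and> U x \<le> B \<and> M * bump R x - b \<le> U x) \<longrightarrow>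
    (let v = (\<lambda>x. if x \<in> ball x0 \<epsilon> then M * bump R x - b else U x) in
      M_minus s lam Lam \<rho> v x0 - Lam * norm (gradient v x0)
      \<ge> c * ((LINT x|lborel. U x / (R + norm x) powr (real DIM('a) + 2 * s))
              - B * R powr (- (real DIM('a) + 2 * s)) * measure lborel (ball x0 \<epsilon>))
        - C * M * bump R x0 * R powr (- 2 * s))"
    using M_minus_touching_lower_bound[OF assms, where 'a='a] by blast
  \<comment> \<open>The exponential is at least exp (- C), and the bump is at least 9/16 on the half ball.\<close>
  define c' where "c' = c * exp (- C) * (9/16)"
  have c': "0 < c'" using c by (simp add: c'_def)
  have "c' * (LINT t:(time_int s R - time_int s (R / 2))|lborel.
            LINT x|lborel. u (x, t) / (R + norm x) powr P) - a \<le> u (x, t)"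
    if R: "0 \<le> \<rho>" "\<rho> < R" "R \<le> R0" and a: "0 \<le> a" and ne: "(kernels s lam Lam \<rho> :: ('a \<Rightarrow> real) set) \<noteq> {}"
      and u: "u \<in> Linfty (UNIV \<times> time_int s R)" "\<forall>x. \<forall>t\<in>{- (R powr (2 * s))..0}. 0 \<le> u (x, t)"
      and visc: "visc_super s lam Lam \<rho> (ball 0 R) (time_int s R) (\<lambda>_. - (R powr (- 2 * s)) * a) u"
      and xt: "(x, t) \<in> cyl s (R / 2)"
    for \<rho> a R x t and u :: "'a \<times> real \<Rightarrow> real"
  proof -
    have Rpos: "0 < R" using R by simp
    define T where "T = R powr (2 * s)"
    define J where "J = time_int s R - time_int s (R / 2)"
    define G where "G t = (LINT x|lborel. u (x, t) / (R + norm x) powr P)" for t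
    define f where "f t = indicator J t * G t" for t
    have T: "0 < T" using Rpos by (simp add: T_def)
    have half: "(R / 2) powr (2 * s) \<le> T" unfolding T_def using Rpos assms by (intro powr_mono2) auto
    have sub: "time_int s (R / 2) \<subseteq> time_int s R" using half by (auto simp: time_int_def T_def)
    have x: "x \<in> ball 0 R" "norm x \<le> R / 2" and t: "t \<in> time_int s R" "t \<in> time_int s (R / 2)"
      using xt sub Rpos by (auto simp: cyl_def)
    have t_le: "- T < t" "t \<le> 0" using t(1) by (auto simp: time_int_def T_def)
    have nn: "0 \<le> u (y, r)" if "r \<in> time_int s R" for y r
      using u(2) that by (auto simp: time_int_def)
    have G0: "0 \<le> G r" if "r \<in> time_int s R" for r
      unfolding G_def using nn[OF that] by (intro integral_nonneg_AE) auto
    have f0: "0 \<le> f r" "r \<in> time_int s R \<Longrightarrow> f r \<le> G r" for r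
      using G0[of r] by (auto simp: f_def J_def indicator_def)
    show ?thesis
    proof (cases "integrable lborel f")
      case False
      \<comment> \<open>The integral of a function that is not integrable is 0, and then the nonnegativity of u suffices.\<close>
      then have "(LINT t:J|lborel. G t) = 0"
        by (simp add: set_lebesgue_integral_def f_def[abs_def] not_integrable_integral_eq)
      then show ?thesis using nn[OF t(1), of x] a by (simp add: G_def J_def)
    next
      case True
      have low: "c' * ((LINT t:J|lborel. G t) - \<eta>) - a \<le> u (x, t)" if \<eta>: "0 < \<eta>" for \<eta>
      proof -
        obtain m where m: "dini_minorant f \<eta> m"
          using dini_minorant_exists[OF _ f0(1) True \<eta>] True by auto
        then have m0: "0 \<le> m r" "m r \<le> (LINT x:{..r}|lborel. f x)" "(LINT x:{..r}|lborel. f x) \<le> m r + \<eta>" for r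
          by (simp_all add: dini_minorant_def)
        \<comment> \<open>The rate f vanishes outside J, so m starts at 0 and has its full size throughout the later cylinder.\<close>
        have m_initial: "m r = 0" if "r \<le> - T" for r
        proof -
          have "indicator {..r} q *\<^sub>R f q = 0" for q
            using that by (auto simp: f_def J_def time_int_def T_def indicator_def)
          then have "(LINT x:{..r}|lborel. f x) = 0" by (simp only: set_lebesgue_integral_def integral_zero)
          then show ?thesis using m0[of r] by simp
        qed
        have m_late: "(LINT t:J|lborel. G t) - \<eta> \<le> m t"
        proof -
          have "indicator {..t} q *\<^sub>R f q = indicator J q *\<^sub>R G q" for q
            using t(2) by (auto simp: f_def J_def time_int_def indicator_def)
          then have "(LINT x:{..t}|lborel. f x) = (LINT t:J|lborel. G t)" by (simp only: set_lebesgue_integral_def)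
          then show ?thesis using m0(3)[of t] by simp
        qed
        have "c * exp (- C * (t + T) / T) * m t * bump R x - a * (t + T) / T \<le> u (x, t)"
          unfolding T_def
        proof (rule barrier_below_supersolution[OF Rpos a c C _ u(1) _ visc _ m0(1) _ f0(1) _ _ x(1) t(1)])
          show "continuous_on UNIV m" using m by (simp add: dini_minorant_def)
          show "\<forall>\<^sub>F \<tau> in at_left r. m r - m \<tau> \<le> (f r + d) * (r - \<tau>)" if "0 < d" for r d
            using m that by (simp add: dini_minorant_def)
        qed (use est R ne u(2) m_initial f0(2) in \<open>auto simp: T_def G_def P_def Let_def\<close>)
        moreover have "c' * m t \<le> c * exp (- C * (t + T) / T) * m t * bump R x"
        proof -
          have "(3/4)\<^sup>2 \<le> bump R x"
            unfolding bump_def by (intro power_mono order_trans[OF bump_half_ball[OF Rpos x(2)] max.cobounded2]) auto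
          then have "9/16 \<le> bump R x" by (simp add: power2_eq_square)
          moreover have "exp (- C) \<le> exp (- C * (t + T) / T)"
            using C T t_le by (simp add: field_simps mult_nonneg_nonpos)
          ultimately have "c * exp (- C) * m t * (9/16) \<le> c * exp (- C * (t + T) / T) * m t * bump R x"
            using c m0(1) by (intro mult_mono mult_nonneg_nonneg) auto
          then show ?thesis by (simp add: c'_def mult_ac)
        qed
        moreover have "c' * ((LINT t:J|lborel. G t) - \<eta>) \<le> c' * m t"
          using m_late c' by (intro mult_left_mono) auto
        moreover have "a * (t + T) / T \<le> a"
          using a t_le T by (simp add: divide_le_eq mult_left_mono)
        ultimately show ?thesis by linarith
      qed
      have "c' * (LINT t:J|lborel. G t) - a \<le> u (x, t)"
      proof (rule field_le_epsilon)
        fix \<eta> :: real assume "0 < \<eta>"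
        then show "c' * (LINT t:J|lborel. G t) - a \<le> u (x, t) + \<eta>"
          using low[of "\<eta> / c'"] c' by (simp add: right_diff_distrib)
      qed
      then show ?thesis by (simp add: J_def G_def)
    qed
  qed
  note pointwise = this
  have ne: "cyl s (R / 2) \<noteq> ({} :: ('a \<times> real) set)" if "0 < R" for R
  proof -
    have "(0, 0) \<in> (cyl s (R / 2) :: ('a \<times> real) set)" using that by (simp add: cyl_def time_int_def)
    then show ?thesis by blast
  qed
  show ?thesis
    unfolding P_def[symmetric]
  proof (intro exI[of _ c'] conjI c' allI impI)
    fix \<rho> a R and u :: "'a \<times> real \<Rightarrow> real"
    assume *: "0 \<le> \<rho>" "0 \<le> a" "\<rho> < R" "R \<le> R0" "(kernels s lam Lam \<rho> :: ('a \<Rightarrow> real) set) \<noteq> {}"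
      "u \<in> Linfty (UNIV \<times> time_int s R)" "\<forall>x. \<forall>t\<in>{- (R powr (2 * s))..0}. 0 \<le> u (x, t)"
      "visc_super s lam Lam \<rho> (ball 0 R) (time_int s R) (\<lambda>_. - (R powr (- 2 * s)) * a) u"
    show "c' * (LINT t:(time_int s R - time_int s (R / 2))|lborel.
            LINT x|lborel. u (x, t) / (R + norm x) powr P) - a \<le> (INF z\<in>cyl s (R / 2). u z)"
    proof (rule cINF_greatest)
      show "cyl s (R / 2) \<noteq> ({} :: ('a \<times> real) set)" using * by (intro ne) simp
      show "c' * (LINT t:(time_int s R - time_int s (R / 2))|lborel.
            LINT x|lborel. u (x, t) / (R + norm x) powr P) - a \<le> u z" if "z \<in> cyl s (R / 2)" for z
        using pointwise[OF *(1,3,4,2,5-8), of "fst z" "snd z"] that by simp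
    qed
  qed
qed

end
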